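(* The problem $\#\mathsf{OV}_{\mathbb{Z}_2}$ on $n+n$ vectors in dimension $d$ can be solved in time $\tilde O(n\cdot 1.36^d)$. Moreover, there are positive numbers $a_m=\Omega\!\left(\frac{1}{m^2\log m}\right)$ such that, for each fixed integer $m\ge 2$, the problem $\#\mathsf{OV}_{\mathbb{Z}_m}$ on $n+n$ vectors in dimension $d$ can be solved in time $\tilde O(n\cdot m^{(1/2-a_m)d})$.
   Context: In $\#\mathsf{OV}_{\mathbb{Z}_m}$ one is given $u_1,\dots,u_n,v_1,\dots,v_n\in\mathbb{Z}_m^d$ (where $\mathbb{Z}_m=\mathbb{Z}/m\mathbb{Z}$) and must output the number of pairs $(i,j)\in[n]\times[n]$ with $\langle u_i,v_j\rangle\equiv 0\pmod m$. $\tilde O$ hides factors polynomial in $d$ and $\log n$. *)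

theory Defs
  imports Complex_Main "HOL-Library.Log_Nat" "HOL-Library.Landau_Symbols" "HOL-Number_Theory.Cong"
begin

section \<open>Random access machines with logarithmic cost\<close>

text \<open>
  The model of computation is a deterministic random access machine over the integers, with
  finitely many named registers (those occurring in the program) and an indirectly addressed
  memory. Programs are structured (while programs) instead of lists of jump instructions. Running
  time is charged logarithmically: an operation costs the bit lengths of its operands (values and
  addresses), and the schoolbook bound for multiplication and division. Hence a unit-cost step on
  words of \<open>O(d + log n)\<close> bits is charged a factor polynomial in \<open>d\<close> and \<open>log n\<close>, and arithmetic
  on long numbers is never free.
\<close>

type_synonym state = "(string \<Rightarrow> int) \<times> (int \<Rightarrow> int)"

datatype aexp = Const int | Reg string | Load aexp
  | Add aexp aexp | Sub aexp aexp | Mul aexp aexp | Div aexp aexp | Mod aexp aexp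

datatype bexp = Less aexp aexp | Eq aexp aexp | BNot bexp | BAnd bexp bexp

datatype com = Skip | Assign string aexp | Store aexp aexp | Seq com com
  | Cond bexp com com | While bexp com

fun aval :: "aexp \<Rightarrow> state \<Rightarrow> int" where
  "aval (Const c) s = c"
| "aval (Reg x) s = fst s x"
| "aval (Load a) s = snd s (aval a s)"
| "aval (Add a b) s = aval a s + aval b s"
| "aval (Sub a b) s = aval a s - aval b s"
| "aval (Mul a b) s = aval a s * aval b s"
| "aval (Div a b) s = aval a s div aval b s"
| "aval (Mod a b) s = aval a s mod aval b s"

fun bval :: "bexp \<Rightarrow> state \<Rightarrow> bool" where
  "bval (Less a b) s \<longleftrightarrow> aval a s < aval b s"
| "bval (Eq a b) s \<longleftrightarrow> aval a s = aval b s"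
| "bval (BNot b) s \<longleftrightarrow> \<not> bval b s"
| "bval (BAnd b c) s \<longleftrightarrow> bval b s \<and> bval c s"

text \<open>Length of the signed binary representation; the sign bit makes it positive.\<close>

definition len :: "int \<Rightarrow> nat" where
  "len x = 1 + floorlog 2 (nat \<bar>x\<bar>)"

fun acost :: "aexp \<Rightarrow> state \<Rightarrow> nat" where
  "acost (Const c) s = len c"
| "acost (Reg x) s = len (fst s x)"
| "acost (Load a) s = acost a s + len (aval a s) + len (snd s (aval a s))"
| "acost (Add a b) s = acost a s + acost b s + len (aval a s) + len (aval b s)"
| "acost (Sub a b) s = acost a s + acost b s + len (aval a s) + len (aval b s)"
| "acost (Mul a b) s = acost a s + acost b s + len (aval a s) * len (aval b s)"
| "acost (Div a b) s = acost a s + acost b s + len (aval a s) * len (aval b s)"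
| "acost (Mod a b) s = acost a s + acost b s + len (aval a s) * len (aval b s)"

fun bcost :: "bexp \<Rightarrow> state \<Rightarrow> nat" where
  "bcost (Less a b) s = acost a s + acost b s + len (aval a s) + len (aval b s)"
| "bcost (Eq a b) s = acost a s + acost b s + len (aval a s) + len (aval b s)"
| "bcost (BNot b) s = bcost b s + 1"
| "bcost (BAnd b c) s = bcost b s + bcost c s + 1"

text \<open>\<open>exec c s t s'\<close>: started in \<open>s\<close>, program \<open>c\<close> halts in \<open>s'\<close> after time \<open>t\<close>.\<close>

inductive exec :: "com \<Rightarrow> state \<Rightarrow> nat \<Rightarrow> state \<Rightarrow> bool" where
  Skip: "exec Skip s 1 s"
| Assign: "exec (Assign x a) s (acost a s + len (aval a s)) ((fst s)(x := aval a s), snd s)"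
| Store: "exec (Store a b) s (acost a s + acost b s + len (aval a s) + len (aval b s))
            (fst s, (snd s)(aval a s := aval b s))"
| Seq: "exec c s t s' \<Longrightarrow> exec c' s' t' s'' \<Longrightarrow> exec (Seq c c') s (t + t') s''"
| CondTrue: "bval b s \<Longrightarrow> exec c s t s' \<Longrightarrow> exec (Cond b c c') s (bcost b s + t) s'"
| CondFalse: "\<not> bval b s \<Longrightarrow> exec c' s t s' \<Longrightarrow> exec (Cond b c c') s (bcost b s + t) s'"
| WhileFalse: "\<not> bval b s \<Longrightarrow> exec (While b c) s (bcost b s) s"
| WhileTrue: "bval b s \<Longrightarrow> exec c s t s' \<Longrightarrow> exec (While b c) s' t' s''
    \<Longrightarrow> exec (While b c) s (bcost b s + t + t') s''"


section \<open>Counting orthogonal vectors modulo \<open>m\<close>\<close>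

text \<open>Lists of \<open>n\<close> vectors of \<open>\<int>\<^sub>m\<close> to the power \<open>d\<close>; residue classes are given by their
  representatives \<open>0, ..., m - 1\<close>.\<close>

definition vector_lists :: "nat \<Rightarrow> nat \<Rightarrow> nat \<Rightarrow> int list list set" where
  "vector_lists m d n =
    {us. length us = n \<and> (\<forall>u\<in>set us. length u = d \<and> set u \<subseteq> {0..<int m})}"

definition count_OV :: "nat \<Rightarrow> nat \<Rightarrow> nat \<Rightarrow> int list list \<Rightarrow> int list list \<Rightarrow> nat" where
  "count_OV m d n us vs =
    card {(i, j). i < n \<and> j < n \<and> [(\<Sum>k<d. us ! i ! k * vs ! j ! k) = 0] (mod int m)}"

text \<open>The input is given by \<open>n\<close> and \<open>d\<close> in registers and the coordinates of
  \<open>u\<^sub>1, ..., u\<^sub>n, v\<^sub>1, ..., v\<^sub>n\<close> in consecutive memory cells from address \<open>0\<close> on;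
  everything else is initially \<open>0\<close>.\<close>

definition input_state :: "nat \<Rightarrow> nat \<Rightarrow> int list list \<Rightarrow> int list list \<Rightarrow> state" where
  "input_state n d us vs =
    ((\<lambda>_. 0)(''n'' := int n, ''d'' := int d),
     (\<lambda>a. let xs = concat us @ concat vs in
        if 0 \<le> a \<and> a < int (length xs) then xs ! nat a else 0))"

definition solves_count_OV_in_time :: "com \<Rightarrow> nat \<Rightarrow> (nat \<Rightarrow> nat \<Rightarrow> real) \<Rightarrow> bool" where
  "solves_count_OV_in_time c m T \<longleftrightarrow>
    (\<forall>n\<ge>1. \<forall>d. \<forall>us\<in>vector_lists m d n. \<forall>vs\<in>vector_lists m d n.
      \<exists>t s. exec c (input_state n d us vs) t s \<and>
        fst s ''out'' = int (count_OV m d n us vs) \<and> real t \<le> T n d)"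

text \<open>\<open>T n d\<close> is at most \<open>f n d\<close> up to a factor polynomial in \<open>d\<close> and \<open>log n\<close>, uniformly
  in \<open>n\<close> and \<open>d\<close>. The \<open>1\<close> keeps the factor from vanishing at \<open>n = 1\<close>, \<open>d = 0\<close>.\<close>

definition soft_O :: "(nat \<Rightarrow> nat \<Rightarrow> real) \<Rightarrow> (nat \<Rightarrow> nat \<Rightarrow> real) set" where
  "soft_O f =
    {T. \<exists>C::real. \<exists>k::nat. \<forall>n\<ge>1. \<forall>d. T n d \<le> C * f n d * (1 + real d + ln (real n)) ^ k}"

definition count_OV_solvable_in_time :: "nat \<Rightarrow> (nat \<Rightarrow> nat \<Rightarrow> real) \<Rightarrow> bool" where
  "count_OV_solvable_in_time m f \<longleftrightarrow> (\<exists>c. \<exists>T\<in>soft_O f. solves_count_OV_in_time c m T)"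

end

theory Submission
  imports Defs
begin

text \<open>
  Put \<open>B = n\<^sup>2 + 1\<close> and \<open>M = B ^ m - 1\<close>. Modulo \<open>M\<close>, \<open>B\<close> is an \<open>m\<close>-th root of unity, and the sum of
  \<open>B\<close> to the power \<open>\<langle>u\<^sub>i, v\<^sub>j\<rangle>\<close> over all pairs, reduced mod \<open>M\<close>, has the wanted count as its lowest
  base-\<open>B\<close> digit. So it suffices to evaluate the bilinear form of the character matrix.

  On a block of six coordinates let \<open>q\<close> be the hyperbolic form \<open>y\<^sub>0 y\<^sub>1 + y\<^sub>2 y\<^sub>3 + y\<^sub>4 y\<^sub>5\<close>. Up to row and
  column scalings and a permutation, the character matrix has the entries \<open>\<omega>\<close> to the power \<open>q(y + z)\<close>,
  which is the all-ones matrix plus a correction with \<open>S\<close> nonzero entries per row and column, where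
  \<open>S = 28\<close> for \<open>m = 2\<close> and \<open>S \<le> m\<^sup>6 - m\<^sup>5\<close> always. The all-ones part is one rank-one node that costs
  either side one choice. The correction is cut into stars, one per row or one per column, costing one
  side \<open>1\<close> and the other \<open>S\<close>. Alternating between row stars and column stars along the blocks balances
  the two sides, so each vector meets about \<open>(1 + sqrt S)\<close> to the power \<open>d / 6\<close> nodes. Finally
  \<open>1 + sqrt 28 < 1.36 ^ 6\<close>, and \<open>1 + sqrt (m\<^sup>6 - m\<^sup>5) \<le> m\<^sup>3 (1 - 1 / (4 m))\<close>.
\<close>

section \<open>Cost of loop-free programs\<close>

text \<open>The hyperbolic form is used because its polarisation is the inner product (after
  swapping paired coordinates) without any division by 2, so even and composite \<open>m\<close>
  need no separate treatment. Six is the block length that reaches 1.36: over \<open>Z_2\<close>, a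
  block of \<open>2k\<close> coordinates leaves \<open>S = 2^(2k-1) - 2^(k-1)\<close> nonzeros per
  row, and \<open>(1 + sqrt S)^(1/(2k))\<close> is about 1.363, 1.359 and 1.364 for lengths 4, 6 and
  8. Stars of one kind only would cost one side \<open>2^(d/6)\<close> and the other
  \<open>(1 + S)^(d/6)\<close> per vector; alternation replaces the larger base by
  \<open>1 + sqrt S\<close>. Working modulo \<open>M\<close> replaces complex roots of unity by
  exact integers of \<open>O(m log n)\<close> bits. No base-\<open>B\<close> digit overflows, since
  at most \<open>n^2 < B\<close> pairs share a residue. The nodes far outnumber the steps available,
  but memory starts at zero and an address is charged only its bit length, so a table indexed by
  nodes is affordable when only visited cells are touched. A depth-first stack enumerates the nodes
  of one vector, which makes every loop iteration loop free and reduces termination and running time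
  to one decreasing potential.\<close>

fun loop_free :: "com \<Rightarrow> bool" where
  "loop_free (Seq c c') \<longleftrightarrow> loop_free c \<and> loop_free c'"
| "loop_free (Cond b c c') \<longleftrightarrow> loop_free c \<and> loop_free c'"
| "loop_free (While b c) \<longleftrightarrow> False"
| "loop_free _ \<longleftrightarrow> True"

fun ceval :: "com \<Rightarrow> state \<Rightarrow> state" where
  "ceval Skip s = s"
| "ceval (Assign x a) s = ((fst s)(x := aval a s), snd s)"
| "ceval (Store a b) s = (fst s, (snd s)(aval a s := aval b s))"
| "ceval (Seq c c') s = ceval c' (ceval c s)"
| "ceval (Cond b c c') s = (if bval b s then ceval c s else ceval c' s)"
| "ceval (While b c) s = s"

definition bounded :: "nat \<Rightarrow> state \<Rightarrow> bool" where
  "bounded L s \<longleftrightarrow> (\<forall>x. len (fst s x) \<le> L) \<and> (\<forall>a. len (snd s a) \<le> L)"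

section \<open>Bit lengths under arithmetic, and costs of expressions and commands\<close>

lemma len_pos: "0 < len x"
  by (simp add: len_def)

lemma len_le_iff: "len x \<le> Suc k \<longleftrightarrow> \<bar>x\<bar> < 2 ^ k"
proof -
  have "len x \<le> Suc k \<longleftrightarrow> floorlog 2 (nat \<bar>x\<bar>) \<le> k"
    by (simp add: len_def)
  also have "\<dots> \<longleftrightarrow> nat \<bar>x\<bar> < 2 ^ k"
    using floorlog_leD[of 2 "nat \<bar>x\<bar>" k] floorlog_leI[of "nat \<bar>x\<bar>" 2 k] by auto
  also have "\<dots> \<longleftrightarrow> \<bar>x\<bar> < 2 ^ k"
    by (metis abs_ge_zero int_nat_eq of_nat_less_numeral_power_cancel_iff)
  finally show ?thesis .
qed

lemma abs_less_len: "\<bar>x\<bar> < 2 ^ (len x - 1)"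
  using len_le_iff[of x "len x - 1"] len_pos[of x] by simp

lemma len_mono: "\<bar>x\<bar> \<le> \<bar>y\<bar> \<Longrightarrow> len x \<le> len y"
  using len_le_iff[of x "len y - 1"] abs_less_len[of y] len_pos[of y] by simp

lemma len_leI: "\<bar>x\<bar> < 2 ^ (len a - 1 + (len b - 1) + 1) \<Longrightarrow> len x \<le> len a + len b"
  using len_le_iff[of x "len a - 1 + (len b - 1) + 1"] len_pos[of a] len_pos[of b] by simp

lemma len_add: "len (x + y) \<le> len x + len y"
proof (rule len_leI)
  let ?p = "len x - 1" and ?q = "len y - 1"
  have "\<bar>x + y\<bar> \<le> \<bar>x\<bar> + \<bar>y\<bar>" by simp
  also have "\<dots> < 2 ^ ?p + 2 ^ ?q"
    using abs_less_len[of x] abs_less_len[of y] by linarith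
  also have "\<dots> \<le> 2 ^ (?p + ?q) + 2 ^ (?p + ?q)"
    by (intro add_mono power_increasing) auto
  finally show "\<bar>x + y\<bar> < 2 ^ (?p + ?q + 1)" by simp
qed

lemma len_uminus: "len (- x) = len x"
  by (simp add: len_def)

lemma len_diff: "len (x - y) \<le> len x + len y"
  using len_add[of x "- y"] by (simp add: len_uminus)

lemma len_mult: "len (x * y) \<le> len x + len y"
proof (rule len_leI)
  let ?p = "len x - 1" and ?q = "len y - 1"
  have "\<bar>x * y\<bar> \<le> 2 ^ ?p * 2 ^ ?q"
    unfolding abs_mult using abs_less_len[of x] abs_less_len[of y]
    by (intro mult_mono) auto
  also have "\<dots> < 2 ^ (?p + ?q + 1)"
    by (simp add: power_add)
  finally show "\<bar>x * y\<bar> < 2 ^ (?p + ?q + 1)" .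
qed

lemma abs_div_le: "\<bar>x div y\<bar> \<le> \<bar>x :: int\<bar>"
proof (cases "y = 0")
  case False
  have *: "\<bar>x div y\<bar> \<le> \<bar>x\<bar>" if "y > 0" for x y :: int
  proof (cases "x \<ge> 0")
    case True
    then show ?thesis
      using that zdiv_mono2[of x 1 y] by (simp add: pos_imp_zdiv_nonneg_iff)
  next
    case False
    then have "x \<le> x div y" "x div y < 0"
      using that zdiv_mono2_neg[of x 1 y] by (auto simp: div_neg_pos_less0)
    then show ?thesis by simp
  qed
  show ?thesis
  proof (cases "y > 0")
    case True
    then show ?thesis by (rule *)
  next
    case False
    then have "\<bar>(- x) div (- y)\<bar> \<le> \<bar>- x\<bar>"
      using \<open>y \<noteq> 0\<close> by (intro *) simp
    then show ?thesis by simp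
  qed
qed auto

lemma len_div: "len (x div y) \<le> len x"
  by (intro len_mono abs_div_le)

text \<open>The term \<open>len x\<close> is there for \<open>y = 0\<close>, where the remainder is
  \<open>x\<close> itself.\<close>

lemma len_mod: "len (x mod y) \<le> len x + len y"
proof (cases "y = 0")
  case False
  then have "\<bar>x mod y\<bar> \<le> \<bar>y\<bar>"
    by (metis abs_mod_less less_imp_le)
  then show ?thesis using len_mono[of "x mod y" y] by simp
qed auto

lemma bounded_mono: "bounded L s \<Longrightarrow> L \<le> L' \<Longrightarrow> bounded L' s"
  unfolding bounded_def using le_trans by blast

lemma bounded_pos: "bounded L s \<Longrightarrow> 1 \<le> L"
  unfolding bounded_def using len_pos[of "fst s []"] by (metis One_nat_def Suc_leI le_trans)

text \<open>Lengths have to stay linear in \<open>L\<close> so that the bound survives nesting; the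
  cost is quadratic because multiplication and division are charged the product of the
  lengths.\<close>

definition aexp_bound :: "aexp \<Rightarrow> nat \<Rightarrow> bool" where
  "aexp_bound a K \<longleftrightarrow> (\<forall>s L. bounded L s \<longrightarrow> len (aval a s) \<le> K * L \<and> acost a s \<le> K * L\<^sup>2)"

lemma aexp_boundD:
  assumes "aexp_bound a K" "bounded L s"
  shows "len (aval a s) \<le> K * L" "acost a s \<le> K * L\<^sup>2"
  using assms unfolding aexp_bound_def by blast+

lemma aexp_bound_len_sq:
  assumes "aexp_bound a K" "bounded L s"
  shows "len (aval a s) \<le> K * L\<^sup>2"
proof -
  have "L \<le> L\<^sup>2" using bounded_pos[OF assms(2)] by (simp add: power2_eq_square)
  then have "K * L \<le> K * L\<^sup>2" by simp
  then show ?thesis using aexp_boundD(1)[OF assms] by linarith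
qed

text \<open>One rule serves all five binary operators: the cost hypothesis contains both the linear
  charge of addition and the product charge of multiplication.\<close>

lemma aexp_bound_binary:
  assumes a: "aexp_bound a K" and b: "aexp_bound b K'"
    and l: "\<And>s. len (aval e s) \<le> len (aval a s) + len (aval b s)"
    and t: "\<And>s. acost e s \<le> acost a s + acost b s + len (aval a s) + len (aval b s)
                 + len (aval a s) * len (aval b s)"
  shows "aexp_bound e (2 * K + 2 * K' + K * K')"
  unfolding aexp_bound_def
proof (intro allI impI conjI)
  fix s L assume s: "bounded L s"
  have a': "len (aval a s) \<le> K * L" "acost a s \<le> K * L\<^sup>2"
    and b': "len (aval b s) \<le> K' * L" "acost b s \<le> K' * L\<^sup>2"
    using aexp_boundD[OF a s] aexp_boundD[OF b s] by auto
  have "len (aval e s) \<le> (K + K') * L"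
    using l[of s] a' b' by (simp add: algebra_simps)
  also have "\<dots> \<le> (2 * K + 2 * K' + K * K') * L"
    by (intro mult_right_mono) auto
  finally show "len (aval e s) \<le> (2 * K + 2 * K' + K * K') * L" .
  have "len (aval a s) * len (aval b s) \<le> K * L * (K' * L)"
    using a' b' by (intro mult_mono) auto
  then have "len (aval a s) * len (aval b s) \<le> K * K' * L\<^sup>2"
    by (simp add: power2_eq_square mult_ac)
  then show "acost e s \<le> (2 * K + 2 * K' + K * K') * L\<^sup>2"
    using t[of s] a' b' aexp_bound_len_sq[OF a s] aexp_bound_len_sq[OF b s]
    by (simp add: add_mult_distrib)
qed

lemma aexp_bound_ex: "\<exists>K. aexp_bound a K"
proof (induction a)
  case (Const c)
  have "aexp_bound (Const c) (len c)"
    unfolding aexp_bound_def using bounded_pos by auto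
  then show ?case ..
next
  case (Reg x)
  have "aexp_bound (Reg x) 1"
    unfolding aexp_bound_def
  proof (intro allI impI)
    fix s L assume "bounded L s"
    moreover from this have "L \<le> L\<^sup>2" using bounded_pos by (simp add: power2_eq_square)
    ultimately show "len (aval (Reg x) s) \<le> 1 * L \<and> acost (Reg x) s \<le> 1 * L\<^sup>2"
      unfolding bounded_def using order_trans by fastforce
  qed
  then show ?case ..
next
  case (Load a)
  then obtain K where K: "aexp_bound a K" by blast
  have "aexp_bound (Load a) (2 * K + 1)"
    unfolding aexp_bound_def
  proof (intro allI impI)
    fix s L assume s: "bounded L s"
    then have L: "L \<le> L\<^sup>2" using bounded_pos by (simp add: power2_eq_square)
    moreover have "len (aval a s) \<le> K * L\<^sup>2" by (rule aexp_bound_len_sq[OF K s])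
    moreover have "len (snd s (aval a s)) \<le> L" using s by (simp add: bounded_def)
    moreover have "len (aval a s) \<le> K * L" "acost a s \<le> K * L\<^sup>2"
      using aexp_boundD[OF K s] by auto
    ultimately show "len (aval (Load a) s) \<le> (2 * K + 1) * L \<and> acost (Load a) s \<le> (2 * K + 1) * L\<^sup>2"
      by (simp add: algebra_simps)
  qed
  then show ?case ..
next
  case (Add a b)
  then show ?case using aexp_bound_binary[of a _ b _ "Add a b"] len_add by force
next
  case (Sub a b)
  then show ?case using aexp_bound_binary[of a _ b _ "Sub a b"] len_diff by force
next
  case (Mul a b)
  then show ?case using aexp_bound_binary[of a _ b _ "Mul a b"] len_mult by force
next
  case (Div a b)
  then show ?case using aexp_bound_binary[of a _ b _ "Div a b"] len_div trans_le_add1 by fastforce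
next
  case (Mod a b)
  then show ?case using aexp_bound_binary[of a _ b _ "Mod a b"] len_mod by force
qed

lemma bexp_bound_ex: "\<exists>K. \<forall>s L. bounded L s \<longrightarrow> bcost b s \<le> K * L\<^sup>2"
proof (induction b)
  case (Less a b)
  obtain K where "aexp_bound (Add a b) K" using aexp_bound_ex by blast
  then show ?case by (auto simp: aexp_bound_def)
next
  case (Eq a b)
  obtain K where "aexp_bound (Add a b) K" using aexp_bound_ex by blast
  then show ?case by (auto simp: aexp_bound_def)
next
  case (BNot b)
  then obtain K where K: "\<forall>s L. bounded L s \<longrightarrow> bcost b s \<le> K * L\<^sup>2" by blast
  have "\<forall>s L. bounded L s \<longrightarrow> bcost (BNot b) s \<le> (K + 1) * L\<^sup>2"
  proof (intro allI impI)
    fix s L assume s: "bounded L s"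
    have "bcost b s \<le> K * L\<^sup>2" using K s by blast
    moreover have "1 \<le> L\<^sup>2" using bounded_pos[OF s] by simp
    ultimately show "bcost (BNot b) s \<le> (K + 1) * L\<^sup>2" by simp
  qed
  then show ?case ..
next
  case (BAnd b c)
  then obtain K K' where K: "\<forall>s L. bounded L s \<longrightarrow> bcost b s \<le> K * L\<^sup>2"
    "\<forall>s L. bounded L s \<longrightarrow> bcost c s \<le> K' * L\<^sup>2" by blast
  have "\<forall>s L. bounded L s \<longrightarrow> bcost (BAnd b c) s \<le> (1 + (K + K')) * L\<^sup>2"
  proof (intro allI impI)
    fix s L assume s: "bounded L s"
    have "bcost b s \<le> K * L\<^sup>2" "bcost c s \<le> K' * L\<^sup>2" using K s by blast+
    moreover have "1 \<le> L\<^sup>2" using bounded_pos[OF s] by simp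
    ultimately show "bcost (BAnd b c) s \<le> (1 + (K + K')) * L\<^sup>2" by (simp add: add_mult_distrib)
  qed
  then show ?case ..
qed

definition com_bound :: "com \<Rightarrow> nat \<Rightarrow> bool" where
  "com_bound c K \<longleftrightarrow> (\<forall>s L. bounded L s \<longrightarrow> bounded (K * L) (ceval c s) \<and>
     (\<exists>t\<le>K * L\<^sup>2. exec c s t (ceval c s)))"

lemma com_boundD:
  assumes "com_bound c K" "bounded L s"
  obtains t where "bounded (K * L) (ceval c s)" "t \<le> K * L\<^sup>2" "exec c s t (ceval c s)"
  using assms unfolding com_bound_def by blast

lemma com_bound_ex: "loop_free c \<Longrightarrow> \<exists>K. com_bound c K"
proof (induction c)
  case Skip
  have "com_bound Skip 1"
    unfolding com_bound_def
  proof (intro allI impI)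
    fix s L assume s: "bounded L s"
    have "1 \<le> L\<^sup>2" using bounded_pos[OF s] by simp
    then show "bounded (1 * L) (ceval Skip s) \<and> (\<exists>t\<le>1 * L\<^sup>2. exec Skip s t (ceval Skip s))"
      using s exec.Skip[of s] by (intro conjI exI[of _ 1]) simp_all
  qed
  then show ?case ..
next
  case (Assign x a)
  obtain K where K: "aexp_bound a K" using aexp_bound_ex by blast
  have "com_bound (Assign x a) (2 * K + 1)"
    unfolding com_bound_def
  proof (intro allI impI conjI)
    fix s L assume s: "bounded L s"
    have l: "len (aval a s) \<le> K * L" "acost a s \<le> K * L\<^sup>2"
      using aexp_boundD[OF K s] by auto
    have "bounded (L + K * L) (ceval (Assign x a) s)"
      using s l by (auto simp: bounded_def trans_le_add1 trans_le_add2)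
    then show "bounded ((2 * K + 1) * L) (ceval (Assign x a) s)"
      by (rule bounded_mono) (simp add: algebra_simps)
    have "len (aval a s) \<le> K * L\<^sup>2" by (rule aexp_bound_len_sq[OF K s])
    then show "\<exists>t\<le>(2 * K + 1) * L\<^sup>2. exec (Assign x a) s t (ceval (Assign x a) s)"
      using l by (intro exI[of _ "acost a s + len (aval a s)"])
        (auto intro: exec.Assign simp: algebra_simps)
  qed
  then show ?case ..
next
  case (Store a b)
  obtain K where K: "aexp_bound a K" using aexp_bound_ex by blast
  obtain K' where K': "aexp_bound b K'" using aexp_bound_ex by blast
  have "com_bound (Store a b) (2 * K + 2 * K' + 1)"
    unfolding com_bound_def
  proof (intro allI impI conjI)
    fix s L assume s: "bounded L s"
    have l: "len (aval a s) \<le> K * L" "acost a s \<le> K * L\<^sup>2"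
        "len (aval b s) \<le> K' * L" "acost b s \<le> K' * L\<^sup>2"
      using aexp_boundD[OF K s] aexp_boundD[OF K' s] by auto
    have "bounded (L + K' * L) (ceval (Store a b) s)"
      using s l by (auto simp: bounded_def trans_le_add1 trans_le_add2)
    then show "bounded ((2 * K + 2 * K' + 1) * L) (ceval (Store a b) s)"
      by (rule bounded_mono) (simp add: algebra_simps)
    have "len (aval a s) \<le> K * L\<^sup>2" "len (aval b s) \<le> K' * L\<^sup>2"
      using aexp_bound_len_sq[OF K s] aexp_bound_len_sq[OF K' s] by auto
    then show "\<exists>t\<le>(2 * K + 2 * K' + 1) * L\<^sup>2. exec (Store a b) s t (ceval (Store a b) s)"
      using l exec.Store[of a b s]
      by (intro exI[of _ "acost a s + acost b s + len (aval a s) + len (aval b s)"])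
        (simp add: add_mult_distrib)
  qed
  then show ?case ..
next
  case (Seq c c')
  then obtain K K' where K: "com_bound c K" and K': "com_bound c' K'" by auto
  have "com_bound (Seq c c') (K + K' * K + K' * K\<^sup>2)"
    unfolding com_bound_def
  proof (intro allI impI conjI)
    fix s L assume s: "bounded L s"
    obtain t where t: "bounded (K * L) (ceval c s)" "t \<le> K * L\<^sup>2" "exec c s t (ceval c s)"
      using com_boundD[OF K s] by blast
    obtain t' where t': "bounded (K' * (K * L)) (ceval c' (ceval c s))" "t' \<le> K' * (K * L)\<^sup>2"
      "exec c' (ceval c s) t' (ceval c' (ceval c s))"
      using com_boundD[OF K' t(1)] by blast
    show "bounded ((K + K' * K + K' * K\<^sup>2) * L) (ceval (Seq c c') s)"
      using t'(1) by (auto intro: bounded_mono simp: algebra_simps)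
    show "\<exists>t\<le>(K + K' * K + K' * K\<^sup>2) * L\<^sup>2. exec (Seq c c') s t (ceval (Seq c c') s)"
      using t t' exec.Seq[OF t(3) t'(3)]
      by (intro exI[of _ "t + t'"]) (simp add: algebra_simps power_mult_distrib)
  qed
  then show ?case ..
next
  case (Cond b c c')
  then obtain K K' where K: "com_bound c K" and K': "com_bound c' K'" by auto
  obtain H where H: "\<forall>s L. bounded L s \<longrightarrow> bcost b s \<le> H * L\<^sup>2" using bexp_bound_ex by blast
  have "com_bound (Cond b c c') (H + K + K')"
    unfolding com_bound_def
  proof (intro allI impI conjI)
    fix s L assume s: "bounded L s"
    obtain t where t: "bounded (K * L) (ceval c s)" "t \<le> K * L\<^sup>2" "exec c s t (ceval c s)"
      using com_boundD[OF K s] by blast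
    obtain t' where t': "bounded (K' * L) (ceval c' s)" "t' \<le> K' * L\<^sup>2" "exec c' s t' (ceval c' s)"
      using com_boundD[OF K' s] by blast
    have b: "bcost b s \<le> H * L\<^sup>2" using H s by blast
    show "bounded ((H + K + K') * L) (ceval (Cond b c c') s)"
      using t(1) t'(1) by (auto intro: bounded_mono simp: algebra_simps)
    show "\<exists>t\<le>(H + K + K') * L\<^sup>2. exec (Cond b c c') s t (ceval (Cond b c c') s)"
    proof (cases "bval b s")
      case True
      then show ?thesis using t b exec.CondTrue[OF True t(3)]
        by (intro exI[of _ "bcost b s + t"]) (simp add: add_mult_distrib)
    next
      case False
      then show ?thesis using t' b exec.CondFalse[OF False t'(3)]
        by (intro exI[of _ "bcost b s + t'"]) (simp add: add_mult_distrib)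
    qed
  qed
  then show ?case ..
qed auto

text \<open>One run of the body may multiply the length bound by \<open>K\<close>, so iterating
  \<open>com_bound\<close> would let the bound grow exponentially. Instead the invariant
  \<open>I\<close> yields the same \<open>L\<close> at every loop head, and its strictly decreasing
  index limits the remaining iterations.\<close>

lemma exec_While:
  assumes c: "com_bound c K" and b: "\<forall>s L. bounded L s \<longrightarrow> bcost b s \<le> H * L\<^sup>2"
    and loop_inv: "\<And>k s. I k s \<Longrightarrow> bval b s \<Longrightarrow> \<exists>k'<k. I k' (ceval c s)"
    and bnd: "\<And>k s. I k s \<Longrightarrow> bounded L s"
    and s: "I (k :: nat) s"
  shows "\<exists>t k' s'. exec (While b c) s t s' \<and> I k' s' \<and> \<not> bval b s' \<and> t \<le> (H + K) * L\<^sup>2 * (k + 1)"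
  using s
proof (induction k arbitrary: s rule: less_induct)
  case (less k)
  have bc: "bcost b s \<le> H * L\<^sup>2" using b bnd[OF less.prems] by blast
  show ?case
  proof (cases "bval b s")
    case True
    obtain t where t: "t \<le> K * L\<^sup>2" "exec c s t (ceval c s)"
      using com_boundD[OF c bnd[OF less.prems]] by blast
    obtain k' where k': "k' < k" "I k' (ceval c s)" using loop_inv[OF less.prems True] by auto
    obtain t' k'' s' where t': "exec (While b c) (ceval c s) t' s'" "I k'' s'" "\<not> bval b s'"
      "t' \<le> (H + K) * L\<^sup>2 * (k' + 1)"
      using less.IH[OF k'] by blast
    have "bcost b s + t + t' \<le> H * L\<^sup>2 + K * L\<^sup>2 + (H + K) * L\<^sup>2 * k"
      using bc t(1) k'(1) by (intro add_mono order_trans[OF t'(4)] mult_left_mono) auto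
    then have "bcost b s + t + t' \<le> (H + K) * L\<^sup>2 * (k + 1)"
      by (simp add: algebra_simps)
    then show ?thesis using exec.WhileTrue[OF True t(2) t'(1)] t' by blast
  next
    case False
    have "bcost b s \<le> (H + K) * L\<^sup>2 * (k + 1)"
      using bc by (simp add: algebra_simps)
    then show ?thesis using exec.WhileFalse[OF False] False less.prems by blast
  qed
qed

section \<open>Factoring the character matrix\<close>

definition digit :: "nat \<Rightarrow> nat \<Rightarrow> nat \<Rightarrow> nat" where
  "digit m z j = z div m ^ j mod m"

definition encode :: "nat \<Rightarrow> (nat \<Rightarrow> nat) \<Rightarrow> nat" where
  "encode m y = y 0 + m * (y 1 + m * (y 2 + m * (y 3 + m * (y 4 + m * y 5))))"

definition quad :: "(nat \<Rightarrow> nat) \<Rightarrow> nat" where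
  "quad y = y 0 * y 1 + y 2 * y 3 + y 4 * y 5"

definition inner6 :: "(nat \<Rightarrow> nat) \<Rightarrow> (nat \<Rightarrow> nat) \<Rightarrow> nat" where
  "inner6 y z = (\<Sum>j<6. y j * z j)"

definition bent :: "nat \<Rightarrow> (nat \<Rightarrow> nat) \<Rightarrow> (nat \<Rightarrow> nat) \<Rightarrow> nat" where
  "bent m y z = ((y 0 + z 1) * (y 1 + z 0) + (y 2 + z 3) * (y 3 + z 2) + (y 4 + z 5) * (y 5 + z 4)) mod m"

lemma less_6_iff: "j < 6 \<longleftrightarrow> j \<in> {0, 1, 2, 3, 4, 5 :: nat}"
  by auto

lemma horner_less:
  fixes a b m k :: nat
  assumes "a < m" "b < m ^ k" shows "a + m * b < m ^ Suc k"
proof -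
  have "a + m * b < m * (b + 1)" using assms by simp
  also have "\<dots> \<le> m * m ^ k" using assms by (intro mult_left_mono) auto
  finally show ?thesis by simp
qed

lemma encode_less:
  assumes "\<And>j. j < 6 \<Longrightarrow> y j < m"
  shows "encode m y < m ^ 6"
proof -
  have "encode m y < m ^ Suc (Suc (Suc (Suc (Suc (Suc 0)))))"
    unfolding encode_def by (intro horner_less assms) (auto intro: assms)
  then show ?thesis by (simp add: eval_nat_numeral)
qed

lemma digit_encode:
  assumes "\<And>j. j < 6 \<Longrightarrow> y j < m" and "j < 6"
  shows "digit m (encode m y) j = y j"
proof -
  have [simp]: "y 0 < m" "y 1 < m" "y (Suc 0) < m" "y 2 < m" "y 3 < m" "y 4 < m" "y 5 < m"
    using assms(1) by auto
  then have m: "m > 0" by linarith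
  have eq: "digit m (a + m * b) 0 = a" "0 < k \<Longrightarrow> digit m (a + m * b) k = digit m b (k - 1)" if "a < m" for a b k
    using that m by (cases k; simp add: digit_def div_mult2_eq)+
  have 5: "digit m (y 5) 0 = y 5"
    by (simp add: digit_def)
  show ?thesis
    using assms(2) unfolding less_6_iff encode_def by (auto simp: eq 5)
qed

lemma bent_commute: "bent m y z = bent m z y"
  unfolding bent_def by (simp add: add.commute mult.commute)

lemma bent_cong: "(\<And>j. j < 6 \<Longrightarrow> z j = z' j) \<Longrightarrow> bent m y z = bent m y z'"
  unfolding bent_def by simp

text \<open>The quadratic form polarises to the inner product, up to swapping the coordinates of each pair.\<close>

lemma bent_cong_inner6: "[bent m y z = quad y + quad z + inner6 y z] (mod m)"
proof -
  have "(y 0 + z 1) * (y 1 + z 0) + (y 2 + z 3) * (y 3 + z 2) + (y 4 + z 5) * (y 5 + z 4)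
        = quad y + quad z + inner6 y z"
    by (simp add: quad_def inner6_def eval_nat_numeral algebra_simps)
  then show ?thesis by (simp add: bent_def cong_def)
qed

text \<open>The factor \<open>m - 1\<close> stands for \<open>-1\<close> in the naturals: the row
  and column scalings cancel \<open>q(y)\<close> and \<open>q(z)\<close> in the polarisation
  identity. Reducing them modulo \<open>m\<close> keeps each exponent below
  \<open>m\<close>.\<close>

lemma bent_exponent:
  assumes "m > 0"
  shows "[(m - 1) * quad y mod m + (m - 1) * quad z mod m + bent m y z = inner6 y z] (mod m)"
proof -
  have "[(m - 1) * quad y mod m + (m - 1) * quad z mod m + bent m y z
     = (m - 1) * quad y + (m - 1) * quad z + (quad y + quad z + inner6 y z)] (mod m)"
    by (intro cong_add bent_cong_inner6) (auto simp: cong_def)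
  also have "(m - 1) * quad y + (m - 1) * quad z + (quad y + quad z + inner6 y z)
     = m * (quad y + quad z) + inner6 y z"
    using assms by (cases m) (auto simp: algebra_simps)
  also have "[m * (quad y + quad z) + inner6 y z = inner6 y z] (mod m)"
    by (simp add: cong_def)
  finally show ?thesis .
qed

section \<open>A root of unity modulo \<open>M\<close> and weighted descents through the
  nodes\<close>

locale ov_kernel =
  fixes m n :: nat and Y :: "nat \<Rightarrow> nat \<Rightarrow> nat \<Rightarrow> nat"
  assumes m_ge: "2 \<le> m" and n_pos: "1 \<le> n" and Y_less: "Y i b j < m"
begin

definition B :: int where "B = int n * int n + 1"
definition M :: int where "M = B ^ m - 1"
definition K :: nat where "K = m ^ 6 + 1"

lemma m_pos: "0 < m" using m_ge by simp

lemma B_ge: "2 \<le> B"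
proof -
  have "1 * 1 \<le> int n * int n" using n_pos by (intro mult_mono) auto
  then show ?thesis by (simp add: B_def)
qed

lemma M_ge: "3 \<le> M"
proof -
  have "2 ^ 2 \<le> B ^ 2" using B_ge by (intro power_mono) auto
  also have "\<dots> \<le> B ^ m" using B_ge m_ge by (intro power_increasing) auto
  finally show ?thesis by (simp add: M_def)
qed

lemma B_power_cong:
  assumes "[e = e'] (mod m)" shows "[B ^ e = B ^ e'] (mod M)"
proof -
  have 1: "[B ^ m = 1] (mod M)"
    by (simp add: M_def cong_iff_dvd_diff)
  have "[B ^ e = B ^ (e mod m)] (mod M)" for e
  proof -
    have "B ^ e = (B ^ m) ^ (e div m) * B ^ (e mod m)"
      by (metis div_mult_mod_eq mult.commute power_add power_mult)
    also have "[\<dots> = 1 ^ (e div m) * B ^ (e mod m)] (mod M)"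
      by (intro cong_mult cong_pow 1) auto
    finally show ?thesis by simp
  qed
  then show ?thesis using assms unfolding cong_def by metis
qed

definition phase :: "nat \<Rightarrow> nat \<Rightarrow> int" where
  "phase i r = B ^ ((m - 1) * quad (Y i r) mod m)"

text \<open>A node with \<open>r\<close> blocks to go is a number in base \<open>K\<close> whose digit is \<open>0\<close> for the all-ones part
  of a block and \<open>1 + z\<close> for the star with centre \<open>z\<close>. With \<open>p\<close> false the next star is entered at its
  centre, with \<open>p\<close> true at its leaves; \<open>p\<close> flips after each star, which balances the two sides.\<close>

fun flow :: "(nat \<Rightarrow> int) \<Rightarrow> nat \<Rightarrow> nat \<Rightarrow> nat \<Rightarrow> bool \<Rightarrow> int" where
  "flow \<phi> i 0 v p = \<phi> v"
| "flow \<phi> i (Suc r) v p = phase i r * (flow \<phi> i r (v * K) p +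
     (if p then \<Sum>z<m ^ 6. (B ^ bent m (Y i r) (digit m z) - 1) * flow \<phi> i r (v * K + (1 + z)) False
      else flow \<phi> i r (v * K + (1 + encode m (Y i r))) True))"

lemma encode_Y_less: "encode m (Y i r) < m ^ 6"
  by (intro encode_less Y_less)

lemma child_div:
  assumes "u div K ^ r = v * K + a" "a < K" shows "u div K ^ Suc r = v"
proof -
  have "u div K ^ Suc r = u div K ^ r div K"
    by (simp add: div_mult2_eq[symmetric] mult.commute)
  then show ?thesis using assms by simp
qed

text \<open>Each block appends one base-\<open>K\<close> digit, so the leaves below \<open>v\<close>
  are exactly numbers with quotient \<open>v\<close> by \<open>K ^ r\<close>. Hence different
  children have disjoint sets of leaves, which is what separates the rank-one parts.\<close>

lemma flow_cong:
  "(\<And>u. u div K ^ r = v \<Longrightarrow> \<phi> u = \<psi> u) \<Longrightarrow> flow \<phi> i r v p = flow \<psi> i r v p"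
proof (induction r arbitrary: v p)
  case (Suc r)
  have *: "flow \<phi> i r (v * K + a) q = flow \<psi> i r (v * K + a) q" if "a < K" for a q
    using that by (intro Suc.IH Suc.prems) (rule child_div)
  have "flow \<phi> i r (v * K) q = flow \<psi> i r (v * K) q" for q
    using *[of 0] by (simp add: K_def)
  moreover have "flow \<phi> i r (v * K + (1 + z)) q = flow \<psi> i r (v * K + (1 + z)) q" if "z < m ^ 6" for z q
    using *[of "1 + z"] that by (simp add: K_def)
  ultimately show ?case
    using encode_Y_less by (auto intro!: sum.cong)
qed simp

lemma flow_scale: "flow (\<lambda>u. c * \<phi> u) i r v p = c * flow \<phi> i r v p"
  by (induction r arbitrary: v p) (simp_all add: sum_distrib_left distrib_left mult.left_commute)

lemma flow_sum: "flow (\<lambda>u. \<Sum>a\<in>A. \<phi> a u) i r v p = (\<Sum>a\<in>A. flow (\<phi> a) i r v p)"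
proof (induction r arbitrary: v p)
  case (Suc r)
  have "(\<Sum>z<m ^ 6. \<Sum>a\<in>A. (B ^ bent m (Y i r) (digit m z) - 1) * flow (\<phi> a) i r (v * K + (1 + z)) False)
    = (\<Sum>a\<in>A. \<Sum>z<m ^ 6. (B ^ bent m (Y i r) (digit m z) - 1) * flow (\<phi> a) i r (v * K + (1 + z)) False)"
    by (rule sum.swap)
  then show ?case
    by (simp add: Suc.IH sum_distrib_left[symmetric] sum.distrib[symmetric])
qed simp

lemma flow_zero:
  assumes "u div K ^ r \<noteq> v"
  shows "flow (\<lambda>u'. of_bool (u' = u)) i r v p = 0"
proof -
  have "flow (\<lambda>u'. of_bool (u' = u)) i r v p = flow (\<lambda>u'. 0 * of_bool (u' = u)) i r v p"
    using assms by (intro flow_cong) auto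
  then show ?thesis
    using flow_scale[of 0 "\<lambda>u'. of_bool (u' = u)" i r v p] by simp
qed

text \<open>The inner flow of an indicator is the entry of the left factor at leaf \<open>u\<close>;
  the outer flow, linear in its argument, pairs these entries with the weights of \<open>j\<close>,
  so no sum over all leaves has to be written. Opposite flags make one side choose the centre of a
  star while the other runs over all centres. Per block the all-ones child contributes 1 and the one
  common star \<open>B ^ ?c - 1\<close>, together \<open>B ^ ?c\<close>, which the phases turn into
  a power with the inner product as exponent.\<close>

lemma flow_flow:
  "[flow (\<lambda>u. flow (\<lambda>u'. of_bool (u' = u)) i r v p) j r v (\<not> p)
    = B ^ (\<Sum>b<r. inner6 (Y i b) (Y j b))] (mod M)"
proof (induction r arbitrary: v p)
  case (Suc r)
  let ?\<delta> = "\<lambda>u u'. of_bool (u' = u) :: int"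
  let ?E = "B ^ (\<Sum>b<r. inner6 (Y i b) (Y j b))"
  let ?c = "bent m (Y i r) (Y j r)"
  define f where "f u = flow (?\<delta> u) i (Suc r) v p" for u
  \<comment> \<open>For leaves below child \<open>a\<close> every other child of the inner descent
    contributes 0, so a single term with some factor \<open>x\<close> remains: 1 at the all-ones
    child, \<open>B ^ ?c - 1\<close> or 1 at the common star, and 0 at a star that \<open>i\<close>
    does not enter.\<close>
  have child: "flow f j r (v * K + a) q = flow (\<lambda>u. phase i r *
      (x * flow (?\<delta> u) i r (v * K + a) q')) j r (v * K + a) q"
    if "a < K" and "\<And>u. u div K ^ r = v * K + a \<Longrightarrow>
        flow (?\<delta> u) i r (v * K) p +
     (if p then \<Sum>z<m ^ 6. (B ^ bent m (Y i r) (digit m z) - 1) * flow (?\<delta> u) i r (v * K + (1 + z)) False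
      else flow (?\<delta> u) i r (v * K + (1 + encode m (Y i r))) True) =
      x * flow (?\<delta> u) i r (v * K + a) q'" for a q q' x
    by (rule flow_cong) (use that(2) in \<open>simp add: f_def\<close>)
  have child': "flow f j r (v * K + a) q =
      phase i r * (x * flow (\<lambda>u. flow (?\<delta> u) i r (v * K + a) q') j r (v * K + a) q)"
    if "a < K" and "\<And>u. u div K ^ r = v * K + a \<Longrightarrow>
        flow (?\<delta> u) i r (v * K) p +
     (if p then \<Sum>z<m ^ 6. (B ^ bent m (Y i r) (digit m z) - 1) * flow (?\<delta> u) i r (v * K + (1 + z)) False
      else flow (?\<delta> u) i r (v * K + (1 + encode m (Y i r))) True) =
      x * flow (?\<delta> u) i r (v * K + a) q'" for a q q' x
    using child[OF that] by (simp only: flow_scale)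
  have zero: "flow (?\<delta> u) i r (v * K + b) q = 0" if "u div K ^ r = v * K + a" "a \<noteq> b" for u a b q
    using that by (intro flow_zero) simp
  have zero0: "flow (?\<delta> u) i r (v * K) q = 0" if "u div K ^ r = v * K + a" "a \<noteq> 0" for u a q
    using zero[OF that] by simp
  have J: "[flow f j r (v * K) (\<not> p) = phase i r * ?E] (mod M)"
  proof -
    have "flow f j r (v * K + 0) (\<not> p) =
      phase i r * (1 * flow (\<lambda>u. flow (?\<delta> u) i r (v * K + 0) p) j r (v * K + 0) (\<not> p))"
    proof (rule child')
      fix u assume "u div K ^ r = v * K + 0"
      then have "flow (?\<delta> u) i r (v * K + (1 + z)) q = 0" for z q
        using zero[of u 0 "1 + z"] by simp
      then show "flow (?\<delta> u) i r (v * K) p +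
        (if p then \<Sum>z<m ^ 6. (B ^ bent m (Y i r) (digit m z) - 1) * flow (?\<delta> u) i r (v * K + (1 + z)) False
        else flow (?\<delta> u) i r (v * K + (1 + encode m (Y i r))) True) =
        1 * flow (?\<delta> u) i r (v * K + 0) p"
        by simp
    qed (simp add: K_def)
    moreover have "[phase i r * (1 * flow (\<lambda>u. flow (?\<delta> u) i r (v * K + 0) p) j r (v * K + 0) (\<not> p))
        = phase i r * (1 * ?E)] (mod M)"
      by (intro cong_mult Suc.IH) auto
    ultimately show ?thesis by simp
  qed
  \<comment> \<open>If \<open>p\<close> holds, \<open>j\<close> fixes the centre and the sum inside
    the descent of \<open>i\<close> collapses to it; otherwise \<open>i\<close> fixes the centre and
    the outer sum collapses.\<close>
  have star: "[(if \<not> p then \<Sum>z<m ^ 6. (B ^ bent m (Y j r) (digit m z) - 1) * flow f j r (v * K + (1 + z)) False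
      else flow f j r (v * K + (1 + encode m (Y j r))) True) = phase i r * ((B ^ ?c - 1) * ?E)] (mod M)"
  proof (cases p)
    case True
    let ?e = "encode m (Y j r)"
    have bent: "bent m (Y i r) (digit m ?e) = ?c"
      by (intro bent_cong digit_encode Y_less)
    have "flow f j r (v * K + (1 + ?e)) True =
      phase i r * ((B ^ ?c - 1) * flow (\<lambda>u. flow (?\<delta> u) i r (v * K + (1 + ?e)) False) j r (v * K + (1 + ?e)) True)"
    proof (rule child')
      show "1 + ?e < K" using encode_Y_less by (simp add: K_def)
      fix u assume u: "u div K ^ r = v * K + (1 + ?e)"
      have flow0: "flow (?\<delta> u) i r (v * K + (1 + z)) False = 0" if "z \<noteq> ?e" for z
        using zero[OF u, of "1 + z"] that by simp
      have "(\<Sum>z<m ^ 6. (B ^ bent m (Y i r) (digit m z) - 1) * flow (?\<delta> u) i r (v * K + (1 + z)) False)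
        = (\<Sum>z\<in>{?e}. (B ^ bent m (Y i r) (digit m z) - 1) * flow (?\<delta> u) i r (v * K + (1 + z)) False)"
        using encode_Y_less flow0 by (intro sum.mono_neutral_right) auto
      then show "flow (?\<delta> u) i r (v * K) p +
        (if p then \<Sum>z<m ^ 6. (B ^ bent m (Y i r) (digit m z) - 1) * flow (?\<delta> u) i r (v * K + (1 + z)) False
        else flow (?\<delta> u) i r (v * K + (1 + encode m (Y i r))) True) =
        (B ^ ?c - 1) * flow (?\<delta> u) i r (v * K + (1 + ?e)) False"
        using True zero0[OF u] bent by simp
    qed
    moreover have "[phase i r * ((B ^ ?c - 1) * flow (\<lambda>u. flow (?\<delta> u) i r (v * K + (1 + ?e)) False) j r (v * K + (1 + ?e)) True)
        = phase i r * ((B ^ ?c - 1) * ?E)] (mod M)"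
      using Suc.IH[of "v * K + (1 + ?e)" False] by (intro cong_mult cong_refl) simp
    ultimately show ?thesis using True by simp
  next
    case False
    let ?e = "encode m (Y i r)"
    have e: "flow f j r (v * K + (1 + ?e)) False =
      phase i r * (1 * flow (\<lambda>u. flow (?\<delta> u) i r (v * K + (1 + ?e)) True) j r (v * K + (1 + ?e)) False)"
      using encode_Y_less zero0 by (intro child') (auto simp: K_def False)
    have ne: "flow f j r (v * K + (1 + z)) False = 0" if "z < m ^ 6" "z \<noteq> ?e" for z
    proof -
      have "flow f j r (v * K + (1 + z)) False =
        phase i r * (0 * flow (\<lambda>u. flow (?\<delta> u) i r (v * K + (1 + z)) True) j r (v * K + (1 + z)) False)"
      proof (rule child')
        fix u assume u: "u div K ^ r = v * K + (1 + z)"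
        then show "flow (?\<delta> u) i r (v * K) p +
        (if p then \<Sum>z<m ^ 6. (B ^ bent m (Y i r) (digit m z) - 1) * flow (?\<delta> u) i r (v * K + (1 + z)) False
        else flow (?\<delta> u) i r (v * K + (1 + encode m (Y i r))) True) =
          0 * flow (?\<delta> u) i r (v * K + (1 + z)) True"
          using False zero0[OF u] zero[OF u, of "1 + encode m (Y i r)"] that by simp
      qed (use that in \<open>simp add: K_def\<close>)
      then show ?thesis by simp
    qed
    have bent: "bent m (Y j r) (digit m ?e) = ?c"
      unfolding bent_commute[of m "Y i r"] by (intro bent_cong digit_encode Y_less)
    have "(\<Sum>z<m ^ 6. (B ^ bent m (Y j r) (digit m z) - 1) * flow f j r (v * K + (1 + z)) False)
      = (\<Sum>z\<in>{?e}. (B ^ bent m (Y j r) (digit m z) - 1) * flow f j r (v * K + (1 + z)) False)"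
      using encode_Y_less ne by (intro sum.mono_neutral_right) auto
    also have "\<dots> = (B ^ ?c - 1) * (phase i r * (1 * flow (\<lambda>u. flow (?\<delta> u) i r (v * K + (1 + ?e)) True) j r (v * K + (1 + ?e)) False))"
      using bent e by simp
    finally have eq: "(\<Sum>z<m ^ 6. (B ^ bent m (Y j r) (digit m z) - 1) * flow f j r (v * K + (1 + z)) False)
      = (B ^ ?c - 1) * (phase i r * (1 * flow (\<lambda>u. flow (?\<delta> u) i r (v * K + (1 + ?e)) True) j r (v * K + (1 + ?e)) False))" .
    have "[(B ^ ?c - 1) * (phase i r * (1 * flow (\<lambda>u. flow (?\<delta> u) i r (v * K + (1 + ?e)) True) j r (v * K + (1 + ?e)) False))
      = (B ^ ?c - 1) * (phase i r * (1 * ?E))] (mod M)"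
      using Suc.IH[of "v * K + (1 + ?e)" True] by (intro cong_mult cong_refl) simp
    then show ?thesis using False by (simp only: eq not_True_eq_False not_False_eq_True if_True mult_1 mult.left_commute)
  qed
  have 1: "[flow f j (Suc r) v (\<not> p) = phase j r * (phase i r * ?E + phase i r * ((B ^ ?c - 1) * ?E))] (mod M)"
    unfolding flow.simps by (intro cong_mult cong_add cong_refl J star)
  have 2: "phase j r * (phase i r * ?E + phase i r * ((B ^ ?c - 1) * ?E))
      = B ^ ((m - 1) * quad (Y i r) mod m + (m - 1) * quad (Y j r) mod m + ?c) * ?E"
    by (simp add: phase_def power_add algebra_simps)
  have 3: "[B ^ ((m - 1) * quad (Y i r) mod m + (m - 1) * quad (Y j r) mod m + ?c) * ?E
      = B ^ inner6 (Y i r) (Y j r) * ?E] (mod M)"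
    by (intro cong_mult cong_refl B_power_cong bent_exponent m_pos)
  have 4: "B ^ inner6 (Y i r) (Y j r) * ?E = B ^ (\<Sum>b<Suc r. inner6 (Y i b) (Y j b))"
    by (simp add: power_add)
  show ?case
    using cong_trans[OF 1[unfolded 2] 3[unfolded 4]] unfolding f_def .
qed simp

text \<open>With exponents reduced modulo \<open>m\<close> the sum is a base-\<open>B\<close>
  expansion whose digits count the pairs by residue. It is at most
  \<open>(B - 1) * B ^ (m - 1) < M\<close>, so reduction modulo \<open>M\<close> returns the sum
  itself, and its digit at \<open>B ^ 0\<close> counts the pairs with residue 0.\<close>

lemma count_from_sum:
  fixes e :: "nat \<Rightarrow> nat \<Rightarrow> nat"
  assumes "[t = (\<Sum>j<n. \<Sum>i<n. B ^ e i j)] (mod M)"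
  shows "t mod M mod B = int (card {(i, j). i < n \<and> j < n \<and> e i j mod m = 0})"
proof -
  let ?s = "\<Sum>j<n. \<Sum>i<n. B ^ (e i j mod m)"
  let ?S = "{(i, j). i < n \<and> j < n \<and> e i j mod m = 0}"
  have "[t = ?s] (mod M)"
    by (rule cong_trans[OF assms]) (intro cong_sum B_power_cong, simp add: cong_def)
  moreover have "0 \<le> ?s"
    using B_ge by (intro sum_nonneg) auto
  moreover have "?s < M"
  proof -
    have "?s \<le> (\<Sum>j<n. \<Sum>i<n. B ^ (m - 1))"
      using B_ge m_ge by (intro sum_mono power_increasing) (auto simp: less_Suc_eq_le[symmetric])
    also have "\<dots> = (B - 1) * B ^ (m - 1)"
      by (simp add: B_def)
    also have "\<dots> = B ^ m - B ^ (m - 1)"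
      using m_ge by (cases m) (auto simp: algebra_simps)
    also have "\<dots> < M"
      using B_ge m_ge by (simp add: M_def)
    finally show ?thesis .
  qed
  ultimately have t: "t mod M = ?s"
    by (simp add: cong_def)
  have S: "?S = {p \<in> {..<n} \<times> {..<n}. e (fst p) (snd p) mod m = 0}" by auto
  have "card ?S \<le> card ({..<n} \<times> {..<n})"
    unfolding S by (intro card_mono) auto
  then have card: "int (card ?S) < B"
    by (simp add: B_def flip: of_nat_mult)
  have "[?s = (\<Sum>j<n. \<Sum>i<n. of_bool (e i j mod m = 0))] (mod B)"
    by (intro cong_sum) (auto simp: cong_def)
  also have "(\<Sum>j<n. \<Sum>i<n. of_bool (e i j mod m = 0)) = (\<Sum>p\<in>{..<n} \<times> {..<n}. of_bool (e (fst p) (snd p) mod m = 0) :: int)"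
    by (subst sum.swap, simp only: sum.cartesian_product, rule sum.cong) auto
  also have "\<dots> = int (card ?S)"
    unfolding S by (simp add: Int_def)
  finally show ?thesis using card t by (simp add: cong_def)
qed

end

section \<open>The program\<close>

fun pow_exp :: "nat \<Rightarrow> aexp" where
  "pow_exp 0 = Const 1"
| "pow_exp (Suc k) = Mul (Reg ''B'') (pow_exp k)"

lemma aval_pow_exp [simp]: "aval (pow_exp k) s = fst s ''B'' ^ k"
  by (induction k) auto

text \<open>The quotient \<open>1 div (1 + x * x)\<close> is the indicator of \<open>x = 0\<close>; this selects a power of \<open>B\<close>
  without branching.\<close>

fun char_exp :: "nat \<Rightarrow> aexp \<Rightarrow> aexp" where
  "char_exp 0 e = Const 0"
| "char_exp (Suc k) e = Add (char_exp k e) (Mul (Div (Const 1) (Add (Const 1)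
     (Mul (Sub e (Const (int k))) (Sub e (Const (int k)))))) (pow_exp k))"

lemma div_one_plus_square: "1 div (1 + x * x) = (of_bool (x = 0) :: int)"
proof (cases "x = 0")
  case False
  then have "0 < x * x" by (auto simp: zero_less_mult_iff)
  then show ?thesis using False by (simp add: div_pos_pos_trivial)
qed simp

lemma aval_char_exp:
  "aval e s = int j \<Longrightarrow> aval (char_exp k e) s = (if j < k then fst s ''B'' ^ j else 0)"
  by (induction k) (auto simp: div_one_plus_square less_Suc_eq)

text \<open>Stack entry \<open>j\<close> occupies the cells \<open>- 1 - 4 * j, \<dots>, - 4 - 4 * j\<close>; the table of node weights starts
  right behind the input, at \<open>2 * n * d\<close>.\<close>

definition cell_exp :: "int \<Rightarrow> aexp" where
  "cell_exp f = Sub (Const (- 1 - f)) (Mul (Const 4) (Reg ''top''))"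

definition table_exp :: aexp where
  "table_exp = Add (Mul (Const 2) (Mul (Reg ''n'') (Reg ''d''))) (Reg ''v'')"

definition push :: "aexp \<Rightarrow> aexp \<Rightarrow> aexp \<Rightarrow> aexp \<Rightarrow> com" where
  "push r v w p = Seq (Store (cell_exp 0) r) (Seq (Store (cell_exp 1) v)
     (Seq (Store (cell_exp 2) w) (Seq (Store (cell_exp 3) p)
     (Assign ''top'' (Add (Reg ''top'') (Const 1))))))"

definition pop :: com where
  "pop = Seq (Assign ''top'' (Sub (Reg ''top'') (Const 1)))
     (Seq (Assign ''r'' (Load (cell_exp 0))) (Seq (Assign ''v'' (Load (cell_exp 1)))
     (Seq (Assign ''w'' (Load (cell_exp 2))) (Assign ''p'' (Load (cell_exp 3))))))"

definition push_root :: com where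
  "push_root = Cond (Less (Reg ''i'') (Reg ''n''))
     (push (Reg ''N'') (Const 0) (Const 1) (Const 0))
     (push (Reg ''N'') (Const 0) (Const 1) (Const 1))"

text \<open>The vectors with \<open>i < n\<close> are handled first and deposit their weights at the
  nodes; the later ones multiply what they find there by their own weights. A node never visited by
  the first group still holds the initial 0, so the table needs no initialisation.\<close>

definition leaf :: com where
  "leaf = Cond (Less (Reg ''i'') (Reg ''n''))
     (Store table_exp (Mod (Add (Load table_exp) (Reg ''w'')) (Reg ''M'')))
     (Assign ''out'' (Mod (Add (Reg ''out'') (Mul (Load table_exp) (Reg ''w''))) (Reg ''M'')))"

text \<open>Beyond coordinate \<open>d\<close> the address would run into the next vector, so the
  last block is padded with zeros, which leave inner products unchanged.\<close>

definition load_digit :: "string \<Rightarrow> int \<Rightarrow> com" where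
  "load_digit y j = Cond (Less (Add (Mul (Const 6) (Reg ''r'')) (Const j)) (Reg ''d''))
     (Assign y (Load (Add (Mul (Reg ''i'') (Reg ''d'')) (Add (Mul (Const 6) (Reg ''r'')) (Const j)))))
     (Assign y (Const 0))"

definition load_block :: com where
  "load_block = Seq (load_digit ''y0'' 0) (Seq (load_digit ''y1'' 1) (Seq (load_digit ''y2'' 2)
     (Seq (load_digit ''y3'' 3) (Seq (load_digit ''y4'' 4) (load_digit ''y5'' 5)))))"

definition quad_exp :: "nat \<Rightarrow> aexp" where
  "quad_exp m = Mod (Mul (Const (int (m - 1))) (Add (Add (Mul (Reg ''y0'') (Reg ''y1''))
     (Mul (Reg ''y2'') (Reg ''y3''))) (Mul (Reg ''y4'') (Reg ''y5'')))) (Const (int m))"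

definition encode_exp :: "nat \<Rightarrow> aexp" where
  "encode_exp m = Add (Reg ''y0'') (Mul (Const (int m)) (Add (Reg ''y1'') (Mul (Const (int m))
     (Add (Reg ''y2'') (Mul (Const (int m)) (Add (Reg ''y3'') (Mul (Const (int m))
     (Add (Reg ''y4'') (Mul (Const (int m)) (Reg ''y5''))))))))))"

definition bent_exp :: "nat \<Rightarrow> nat \<Rightarrow> aexp" where
  "bent_exp m z = (let c = (\<lambda>j. Const (int (digit m z j))) in
     Mod (Add (Add (Mul (Add (Reg ''y0'') (c 1)) (Add (Reg ''y1'') (c 0)))
       (Mul (Add (Reg ''y2'') (c 3)) (Add (Reg ''y3'') (c 2))))
       (Mul (Add (Reg ''y4'') (c 5)) (Add (Reg ''y5'') (c 4)))) (Const (int m)))"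

definition star :: "nat \<Rightarrow> nat \<Rightarrow> com" where
  "star m z = Cond (Eq (bent_exp m z) (Const 0)) Skip
     (push (Reg ''r'') (Add (Reg ''v'') (Const (1 + int z)))
       (Mod (Mul (Reg ''w'') (Sub (char_exp m (bent_exp m z)) (Const 1))) (Reg ''M'')) (Const 0))"

text \<open>For fixed \<open>m\<close> there are constantly many centres: the loop over them is
  unrolled, with the digits of each centre as constants, and the loop body stays loop free.\<close>

definition stars :: "nat \<Rightarrow> nat list \<Rightarrow> com" where
  "stars m zs = foldr (\<lambda>z. Seq (star m z)) zs Skip"

definition expand :: "nat \<Rightarrow> com" where
  "expand m = Seq (Assign ''r'' (Sub (Reg ''r'') (Const 1))) (Seq load_block
     (Seq (Assign ''w'' (Mod (Mul (Reg ''w'') (char_exp m (quad_exp m))) (Reg ''M'')))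
     (Seq (Assign ''v'' (Mul (Reg ''v'') (Const (int (m ^ 6 + 1)))))
     (Seq (push (Reg ''r'') (Reg ''v'') (Reg ''w'') (Reg ''p''))
     (Cond (Eq (Reg ''p'') (Const 0))
       (push (Reg ''r'') (Add (Reg ''v'') (Add (Const 1) (encode_exp m))) (Reg ''w'') (Const 1))
       (stars m [0..<m ^ 6]))))))"

definition process :: "nat \<Rightarrow> com" where
  "process m = Seq pop (Cond (Eq (Reg ''r'') (Const 0)) leaf (expand m))"

definition next_vector :: com where
  "next_vector = Cond (Eq (Reg ''top'') (Const 0))
     (Seq (Assign ''i'' (Add (Reg ''i'') (Const 1))) push_root) Skip"

definition body :: "nat \<Rightarrow> com" where
  "body m = Seq (process m) next_vector"

definition init :: "nat \<Rightarrow> com" where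
  "init m = Seq (Assign ''B'' (Add (Mul (Reg ''n'') (Reg ''n'')) (Const 1)))
     (Seq (Assign ''M'' (Sub (pow_exp m) (Const 1)))
     (Seq (Assign ''N'' (Div (Add (Reg ''d'') (Const 5)) (Const 6))) push_root))"

definition guard :: bexp where
  "guard = Less (Reg ''i'') (Mul (Const 2) (Reg ''n''))"

definition final :: com where
  "final = Assign ''out'' (Mod (Mod (Reg ''out'') (Reg ''M'')) (Reg ''B''))"

definition program :: "nat \<Rightarrow> com" where
  "program m = Seq (init m) (Seq (While guard (body m)) final)"

lemma loop_free_stars: "loop_free (stars m zs)"
  by (induction zs) (auto simp: stars_def star_def push_def)

lemma loop_free_body: "loop_free (body m)"
  by (auto simp: body_def process_def pop_def leaf_def expand_def load_block_def load_digit_def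
    push_def next_vector_def push_root_def loop_free_stars)

lemma loop_free_init: "loop_free (init m)"
  by (auto simp: init_def push_root_def push_def)

section \<open>Work per stack entry and machine configurations\<close>

type_synonym entry = "nat \<times> nat \<times> int \<times> bool"

text \<open>A bound on the number of entries ever produced from one entry with \<open>r\<close>
  blocks to go, itself included. Counting the entry itself makes the total drop strictly whenever an
  entry is processed.\<close>

fun work :: "nat \<Rightarrow> nat \<Rightarrow> bool \<Rightarrow> nat" where
  "work S 0 p = 1"
| "work S (Suc r) p = 1 + work S r p + (if p then S * work S r False else work S r True)"

lemma work_pos: "1 \<le> work S r p"
  by (cases r) auto

lemma work_mono: "1 \<le> S \<Longrightarrow> work S r False \<le> work S r True"
proof (induction r)
  case (Suc r)
  have "1 + work S r False + work S r True \<le> 1 + work S r True + S * work S r False"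
  proof -
    have "work S r False \<le> S * work S r False" using Suc.prems by simp
    then show ?thesis by simp
  qed
  then show ?case by simp
qed simp

locale ov_machine =
  fixes m n d S :: nat and x :: "nat \<Rightarrow> nat"
  assumes m_ge2: "2 \<le> m" and n_ge1: "1 \<le> n" and x_less: "x a < m" and S_ge: "1 \<le> S"
    and S_le: "S \<le> m ^ 6"
    and S_bent: "card {z. z < m ^ 6 \<and> bent m y (digit m z) \<noteq> 0} \<le> S"
begin

definition Y :: "nat \<Rightarrow> nat \<Rightarrow> nat \<Rightarrow> nat" where
  "Y i b j = (if 6 * b + j < d then x (i * d + (6 * b + j)) else 0)"

definition N :: nat where "N = (d + 5) div 6"

sublocale ov_kernel m n Y
  by unfold_locales (use m_ge2 n_ge1 x_less in \<open>auto simp: Y_def\<close>)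

text \<open>A common bound for all register and memory contents. The power of \<open>B\<close>
  absorbs \<open>n\<close>, \<open>m\<close> and residues modulo \<open>M\<close>; the other factor
  absorbs \<open>d\<close> and the node numbers, and together with one factor \<open>B\<close> also
  the stack height. For fixed \<open>m\<close> its length is \<open>O(d + log n)\<close>.\<close>

definition V :: int where "V = B ^ (m + 1) * (int m ^ 6 + 2) ^ d"

lemma N_le: "N \<le> d" by (auto simp: N_def)

lemma B_le_V: "B ^ k \<le> V" if "k \<le> m + 1"
proof -
  have "B ^ k \<le> B ^ (m + 1)"
    using B_ge that by (intro power_increasing) auto
  also have "\<dots> * 1 \<le> V"
    unfolding V_def using B_ge by (intro mult_left_mono one_le_power) auto
  finally show ?thesis by simp
qed

lemma power_le_V: "a * (int m ^ 6 + 2) ^ k \<le> V" if "0 \<le> a" "a \<le> B" "k \<le> d"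
proof -
  have "B ^ 1 \<le> B ^ (m + 1)" using B_ge by (intro power_increasing) auto
  then have "a \<le> B ^ (m + 1)" using that by simp
  moreover have "(int m ^ 6 + 2) ^ k \<le> (int m ^ 6 + 2) ^ d"
    using that by (intro power_increasing) auto
  ultimately show ?thesis unfolding V_def
    using that B_ge by (intro mult_mono) auto
qed

lemma two_n_le_B: "2 * int n \<le> B"
proof -
  have "0 \<le> (int n - 1)\<^sup>2" by simp
  then show ?thesis by (simp add: B_def power2_eq_square algebra_simps)
qed

lemma M_less_V: "M < V"
  using B_le_V[of m] by (simp add: M_def)

lemma m_le_V: "int m \<le> V"
proof -
  have "m < 2 ^ m" by (rule less_exp)
  then have "int m < 2 ^ m" by (metis of_nat_less_iff of_nat_numeral of_nat_power)
  also have "(2 :: int) ^ m \<le> B ^ m" using B_ge by (intro power_mono) auto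
  also have "\<dots> \<le> V" by (rule B_le_V) simp
  finally show ?thesis by simp
qed

lemma K_power_le_V: "int (K ^ k) \<le> V" if "k \<le> d"
proof -
  have "int (K ^ k) \<le> (int m ^ 6 + 2) ^ k"
    unfolding of_nat_power by (intro power_mono) (auto simp: K_def)
  also have "1 * \<dots> \<le> V" using that B_ge by (intro power_le_V) auto
  finally show ?thesis by simp
qed

lemma d_le_V: "int d \<le> V"
proof -
  have "d < 2 ^ d" by (rule less_exp)
  also have "2 ^ d \<le> K ^ d"
  proof (rule power_mono)
    have "1 \<le> m ^ 6" using m_ge2 by simp
    then show "2 \<le> K" by (simp add: K_def)
  qed simp
  finally have "int d \<le> int (K ^ d)" by linarith
  also have "\<dots> \<le> V" by (rule K_power_le_V) simp
  finally show ?thesis .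
qed

lemma one_less_V: "1 < V"
  using B_le_V[of 1] B_ge by simp

fun valid :: "entry \<Rightarrow> bool" where
  "valid (r, v, w, p) \<longleftrightarrow> r \<le> N \<and> v < K ^ (N - r) \<and> 0 \<le> w \<and> w < M"

definition mem_ok :: "entry list \<Rightarrow> (int \<Rightarrow> int) \<Rightarrow> bool" where
  "mem_ok st \<mu> \<longleftrightarrow> (\<forall>a. \<bar>\<mu> a\<bar> \<le> V) \<and> (\<forall>a<2 * n * d. \<mu> (int a) = int (x a)) \<and>
     (\<forall>j<length st. case st ! j of (r, v, w, p) \<Rightarrow> \<mu> (- 1 - 4 * int j) = int r \<and>
        \<mu> (- 2 - 4 * int j) = int v \<and> \<mu> (- 3 - 4 * int j) = w \<and> \<mu> (- 4 - 4 * int j) = of_bool p)"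

text \<open>Register \<open>''top''\<close> is exempt from the bound \<open>V\<close>, so that a
  push needs no argument about the stack height; that height is bounded once per iteration, through
  the remaining work.\<close>

definition conf :: "nat \<Rightarrow> entry list \<Rightarrow> state \<Rightarrow> bool" where
  "conf i st s \<longleftrightarrow> (\<forall>y. y \<noteq> ''top'' \<longrightarrow> \<bar>fst s y\<bar> \<le> V) \<and> fst s ''n'' = int n \<and> fst s ''d'' = int d \<and>
     fst s ''B'' = B \<and> fst s ''M'' = M \<and> fst s ''N'' = int N \<and> fst s ''i'' = int i \<and>
     fst s ''top'' = int (length st) \<and> mem_ok st (snd s) \<and> (\<forall>e\<in>set st. valid e)"

lemma valid_bounds:
  assumes "valid (r, v, w, p)"
  shows "int r \<le> V" "int v \<le> V" "\<bar>w\<bar> \<le> V" "of_bool p \<le> V"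
proof -
  show "int r \<le> V" using assms N_le d_le_V by simp
  have "int v \<le> int (K ^ (N - r))" using assms by simp
  also have "\<dots> \<le> V" using N_le by (intro K_power_le_V) simp
  finally show "int v \<le> V" .
  show "\<bar>w\<bar> \<le> V" using assms M_less_V by simp
  show "of_bool p \<le> V" using one_less_V by simp
qed

text \<open>The four expressions are evaluated one after the other while the cells of the new entry
  are being written. Quantifying over the memory says that they read registers only, so these writes
  cannot disturb them.\<close>

lemma conf_push:
  assumes conf: "conf i st s" and e: "valid (r, v, w, p)"
    and a: "\<And>\<mu>. aval a (fst s, \<mu>) = int r" "\<And>\<mu>. aval b (fst s, \<mu>) = int v"
      "\<And>\<mu>. aval c (fst s, \<mu>) = w" "\<And>\<mu>. aval q (fst s, \<mu>) = of_bool p"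
  shows "conf i (st @ [(r, v, w, p)]) (ceval (push a b c q) s) \<and>
    fst (ceval (push a b c q) s) = (fst s)(''top'' := int (length st) + 1) \<and>
    (\<forall>k\<ge>0. snd (ceval (push a b c q) s) k = snd s k)"
proof -
  let ?t = "int (length st)"
  let ?\<mu> = "(snd s)(- 1 - 4 * ?t := int r, - 2 - 4 * ?t := int v, - 3 - 4 * ?t := w, - 4 - 4 * ?t := of_bool p)"
  have top: "fst s ''top'' = ?t" and mem: "mem_ok st (snd s)" using conf by (auto simp: conf_def)
  have a': "aval a s = int r" using a(1)[of "snd s"] by simp
  have ev: "ceval (push a b c q) s = ((fst s)(''top'' := ?t + 1), ?\<mu>)"
    by (simp add: push_def cell_exp_def a a' top)
  have "mem_ok (st @ [(r, v, w, p)]) ?\<mu>"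
    unfolding mem_ok_def
  proof (intro conjI allI impI)
    fix k show "\<bar>?\<mu> k\<bar> \<le> V"
      using mem valid_bounds[OF e] by (auto simp: mem_ok_def)
  next
    fix k assume "k < 2 * n * d"
    then show "?\<mu> (int k) = int (x k)" using mem by (auto simp: mem_ok_def)
  next
    fix j assume j: "j < length (st @ [(r, v, w, p)])"
    show "case (st @ [(r, v, w, p)]) ! j of (r, v, w, p) \<Rightarrow> ?\<mu> (- 1 - 4 * int j) = int r \<and>
        ?\<mu> (- 2 - 4 * int j) = int v \<and> ?\<mu> (- 3 - 4 * int j) = w \<and> ?\<mu> (- 4 - 4 * int j) = of_bool p"
    proof (cases "j = length st")
      case False
      then have "j < length st" using j by simp
      moreover from this have "?\<mu> (- 1 - 4 * int j) = snd s (- 1 - 4 * int j)"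
        "?\<mu> (- 2 - 4 * int j) = snd s (- 2 - 4 * int j)"
        "?\<mu> (- 3 - 4 * int j) = snd s (- 3 - 4 * int j)"
        "?\<mu> (- 4 - 4 * int j) = snd s (- 4 - 4 * int j)"
        unfolding fun_upd_apply by presburger+
      ultimately show ?thesis using mem unfolding mem_ok_def
        by (simp only: nth_append if_True)
    qed simp
  qed
  then have "conf i (st @ [(r, v, w, p)]) (ceval (push a b c q) s)"
    using conf e unfolding ev by (auto simp: conf_def)
  then show ?thesis unfolding ev by auto
qed

definition regs :: "nat \<Rightarrow> nat \<Rightarrow> int \<Rightarrow> (nat \<Rightarrow> nat) \<Rightarrow> (string \<Rightarrow> int) \<Rightarrow> bool" where
  "regs r v w y \<rho> \<longleftrightarrow> \<rho> ''r'' = int r \<and> \<rho> ''v'' = int v \<and> \<rho> ''w'' = w \<and> \<rho> ''y0'' = int (y 0) \<and>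
     \<rho> ''y1'' = int (y 1) \<and> \<rho> ''y2'' = int (y 2) \<and> \<rho> ''y3'' = int (y 3) \<and> \<rho> ''y4'' = int (y 4) \<and>
     \<rho> ''y5'' = int (y 5)"

lemma aval_bent_exp: "regs r v w y (fst s) \<Longrightarrow> aval (bent_exp m z) s = int (bent m y (digit m z))"
  by (simp add: regs_def bent_exp_def bent_def Let_def zmod_int)

lemma aval_quad_exp: "regs r v w y (fst s) \<Longrightarrow> aval (quad_exp m) s = int ((m - 1) * quad y mod m)"
  by (simp add: regs_def quad_exp_def quad_def zmod_int)

lemma aval_encode_exp: "regs r v w y (fst s) \<Longrightarrow> aval (encode_exp m) s = int (encode m y)"
  by (simp add: regs_def encode_exp_def encode_def)

definition star_entry :: "nat \<Rightarrow> nat \<Rightarrow> int \<Rightarrow> (nat \<Rightarrow> nat) \<Rightarrow> nat \<Rightarrow> entry" where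
  "star_entry r v w y z = (r, v + (1 + z), w * (B ^ bent m y (digit m z) - 1) mod M, False)"

lemma conf_stars:
  assumes "conf i st s" "regs r v w y (fst s)" "\<And>z. z \<in> set zs \<Longrightarrow> valid (star_entry r v w y z)"
  shows "conf i (st @ map (star_entry r v w y) (filter (\<lambda>z. bent m y (digit m z) \<noteq> 0) zs)) (ceval (stars m zs) s) \<and>
    (\<forall>k. k \<noteq> ''top'' \<longrightarrow> fst (ceval (stars m zs) s) k = fst s k) \<and>
    (\<forall>k\<ge>0. snd (ceval (stars m zs) s) k = snd s k)"
  using assms
proof (induction zs arbitrary: st s)
  case (Cons z zs)
  note conf = Cons.prems(1) and regs = Cons.prems(2)
  have bent: "aval (bent_exp m z) (fst s, \<mu>) = int (bent m y (digit m z))" for \<mu>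
    using regs by (intro aval_bent_exp) simp
  have bent': "aval (bent_exp m z) s = int (bent m y (digit m z))"
    using regs by (rule aval_bent_exp)
  have unfold: "ceval (stars m (z # zs)) s = ceval (stars m zs) (ceval (star m z) s)"
    by (simp add: stars_def)
  show ?case
  proof (cases "bent m y (digit m z) = 0")
    case True
    then have "ceval (star m z) s = s" by (simp add: star_def bent')
    then show ?thesis using Cons.IH[OF conf regs] Cons.prems(3) True unfold by simp
  next
    case False
    let ?s = "ceval (star m z) s"
    let ?e = "star_entry r v w y z"
    have less: "bent m y (digit m z) < m" using m_ge2 by (simp add: bent_def)
    have s: "?s = ceval (push (Reg ''r'') (Add (Reg ''v'') (Const (1 + int z)))
       (Mod (Mul (Reg ''w'') (Sub (char_exp m (bent_exp m z)) (Const 1))) (Reg ''M'')) (Const 0)) s"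
      using False by (simp add: star_def bent')
    have M: "fst s ''M'' = M" "fst s ''B'' = B" using conf by (auto simp: conf_def)
    have *: "conf i (st @ [?e]) ?s \<and> fst ?s = (fst s)(''top'' := int (length st) + 1) \<and> (\<forall>k\<ge>0. snd ?s k = snd s k)"
      unfolding s star_entry_def
    proof (intro conf_push conf)
      show "valid (r, v + (1 + z), w * (B ^ bent m y (digit m z) - 1) mod M, False)"
        using Cons.prems(3)[of z] by (simp add: star_entry_def)
    qed (use regs M less in \<open>simp_all add: regs_def aval_char_exp[OF bent]\<close>)
    then have conf': "conf i (st @ [?e]) ?s" and fst': "fst ?s = (fst s)(''top'' := int (length st) + 1)"
      and snd': "\<forall>k\<ge>0. snd ?s k = snd s k"
      by blast+
    have "regs r v w y (fst ?s)" unfolding fst' using regs by (simp add: regs_def)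
    from Cons.IH[OF conf' this] Cons.prems(3) show ?thesis
      using False snd' unfolding unfold by (simp add: fst')
  qed
qed (simp add: stars_def)

fun children :: "nat \<Rightarrow> entry \<Rightarrow> entry list" where
  "children i (0, v, w, p) = []"
| "children i (Suc r, v, w, p) = (let w' = w * phase i r mod M in (r, v * K, w', p) #
     (if p then map (star_entry r (v * K) w' (Y i r))
              (filter (\<lambda>z. bent m (Y i r) (digit m z) \<noteq> 0) [0..<m ^ 6])
      else [(r, v * K + (1 + encode m (Y i r)), w', True)]))"

lemma valid_child:
  assumes "valid (Suc r, v, w, p)" "a < K" "0 \<le> w'" "w' < M"
  shows "valid (r, v * K + a, w', q)"
proof -
  have "v * K + a < (v + 1) * K" using assms by simp
  also have "\<dots> \<le> K ^ (N - Suc r) * K" using assms by (intro mult_right_mono) auto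
  also have "\<dots> = K ^ (N - r)"
    using assms by (simp add: power_Suc2[symmetric] Suc_diff_Suc del: power_Suc)
  finally show ?thesis using assms by simp
qed

lemma confD:
  assumes "conf i st s"
  shows "y \<noteq> ''top'' \<Longrightarrow> \<bar>fst s y\<bar> \<le> V" "fst s ''n'' = int n" "fst s ''d'' = int d" "fst s ''B'' = B"
    "fst s ''M'' = M" "fst s ''N'' = int N" "fst s ''i'' = int i" "fst s ''top'' = int (length st)"
    "mem_ok st (snd s)" "e \<in> set st \<Longrightarrow> valid e"
  using assms unfolding conf_def by blast+

lemma confI:
  assumes "\<And>y. y \<noteq> ''top'' \<Longrightarrow> \<bar>fst s y\<bar> \<le> V" "fst s ''n'' = int n" "fst s ''d'' = int d" "fst s ''B'' = B"
    "fst s ''M'' = M" "fst s ''N'' = int N" "fst s ''i'' = int i" "fst s ''top'' = int (length st)"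
    "mem_ok st (snd s)" "\<And>e. e \<in> set st \<Longrightarrow> valid e"
  shows "conf i st s"
  using assms unfolding conf_def by blast

lemma conf_assign:
  assumes conf: "conf i st s" and c: "\<bar>c\<bar> \<le> V"
    and y: "y \<noteq> ''n''" "y \<noteq> ''d''" "y \<noteq> ''B''" "y \<noteq> ''M''" "y \<noteq> ''N''" "y \<noteq> ''i''" "y \<noteq> ''top''"
  shows "conf i st ((fst s)(y := c), snd s)"
proof (rule confI)
  have upd: "fst ((fst s)(y := c), snd s) z = fst s z" if "y \<noteq> z" for z
    using that by simp
  show "\<bar>fst ((fst s)(y := c), snd s) z\<bar> \<le> V" if "z \<noteq> ''top''" for z
    using confD(1)[OF conf that] c by simp
  show "fst ((fst s)(y := c), snd s) ''n'' = int n" by (rule trans[OF upd[OF y(1)] confD(2)[OF conf]])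
  show "fst ((fst s)(y := c), snd s) ''d'' = int d" by (rule trans[OF upd[OF y(2)] confD(3)[OF conf]])
  show "fst ((fst s)(y := c), snd s) ''B'' = B" by (rule trans[OF upd[OF y(3)] confD(4)[OF conf]])
  show "fst ((fst s)(y := c), snd s) ''M'' = M" by (rule trans[OF upd[OF y(4)] confD(5)[OF conf]])
  show "fst ((fst s)(y := c), snd s) ''N'' = int N" by (rule trans[OF upd[OF y(5)] confD(6)[OF conf]])
  show "fst ((fst s)(y := c), snd s) ''i'' = int i" by (rule trans[OF upd[OF y(6)] confD(7)[OF conf]])
  show "fst ((fst s)(y := c), snd s) ''top'' = int (length st)" by (rule trans[OF upd[OF y(7)] confD(8)[OF conf]])
  show "mem_ok st (snd ((fst s)(y := c), snd s))" unfolding snd_conv by (rule confD(9)[OF conf])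
  show "valid e" if "e \<in> set st" for e by (rule confD(10)[OF conf that])
qed

lemma mem_ok_cell:
  assumes "mem_ok st \<mu>" "j < length st" "st ! j = (r, v, w, p)"
  shows "\<mu> (- 1 - 4 * int j) = int r \<and> \<mu> (- 2 - 4 * int j) = int v \<and> \<mu> (- 3 - 4 * int j) = w \<and>
    \<mu> (- 4 - 4 * int j) = of_bool p"
  using assms(1)[unfolded mem_ok_def, THEN conjunct2, THEN conjunct2, rule_format, OF assms(2)]
  unfolding assms(3) by simp

lemma mem_okI:
  assumes "\<And>a. \<bar>\<mu> a\<bar> \<le> V" "\<And>a. a < 2 * n * d \<Longrightarrow> \<mu> (int a) = int (x a)"
    and "\<And>j r v w p. j < length st \<Longrightarrow> st ! j = (r, v, w, p) \<Longrightarrow> \<mu> (- 1 - 4 * int j) = int r \<and>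
      \<mu> (- 2 - 4 * int j) = int v \<and> \<mu> (- 3 - 4 * int j) = w \<and> \<mu> (- 4 - 4 * int j) = of_bool p"
  shows "mem_ok st \<mu>"
  using assms unfolding mem_ok_def by (simp split: prod.split)

lemma mem_ok_append:
  assumes "mem_ok (st @ es) \<mu>"
  shows "mem_ok st \<mu>"
proof (rule mem_okI)
  fix j r v w p assume "j < length st" "st ! j = (r, v, w, p)"
  then show "\<mu> (- 1 - 4 * int j) = int r \<and> \<mu> (- 2 - 4 * int j) = int v \<and> \<mu> (- 3 - 4 * int j) = w \<and>
    \<mu> (- 4 - 4 * int j) = of_bool p"
    by (intro mem_ok_cell[OF assms]) (simp_all add: nth_append)
qed (use assms in \<open>simp_all add: mem_ok_def\<close>)

text \<open>Table cells lie behind the input and stack cells at negative addresses, so neither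
  region can overwrite the other however far both grow.\<close>

lemma mem_ok_upd:
  assumes "mem_ok st \<mu>" "\<bar>c\<bar> \<le> V" "2 * n * d \<le> a"
  shows "mem_ok st (\<mu>(int a := c))"
proof (rule mem_okI)
  fix j r v w p assume "j < length st" "st ! j = (r, v, w, p)"
  from mem_ok_cell[OF assms(1) this]
  show "(\<mu>(int a := c)) (- 1 - 4 * int j) = int r \<and> (\<mu>(int a := c)) (- 2 - 4 * int j) = int v \<and>
    (\<mu>(int a := c)) (- 3 - 4 * int j) = w \<and> (\<mu>(int a := c)) (- 4 - 4 * int j) = of_bool p"
    by auto
qed (use assms in \<open>auto simp: mem_ok_def\<close>)

lemma conf_pop:
  assumes conf: "conf i (st @ [(r, v, w, p)]) s"
  defines "s' \<equiv> ceval pop s"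
  shows "conf i st s'" "fst s' ''r'' = int r" "fst s' ''v'' = int v" "fst s' ''w'' = w"
    "fst s' ''p'' = of_bool p" "fst s' ''out'' = fst s ''out''" "snd s' = snd s"
proof -
  let ?t = "int (length st)"
  have top: "fst s ''top'' = ?t + 1" and mem: "mem_ok (st @ [(r, v, w, p)]) (snd s)"
    and val: "valid (r, v, w, p)"
    using confD(8,9)[OF conf] confD(10)[OF conf, of "(r, v, w, p)"] by (simp_all del: valid.simps)
  have "snd s (- 1 - 4 * ?t) = int r \<and> snd s (- 2 - 4 * ?t) = int v \<and> snd s (- 3 - 4 * ?t) = w
    \<and> snd s (- 4 - 4 * ?t) = of_bool p"
    using mem_ok_cell[OF mem, of "length st"] by simp
  then have s': "s' = ((fst s)(''top'' := ?t, ''r'' := int r, ''v'' := int v, ''w'' := w, ''p'' := of_bool p), snd s)"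
    by (simp add: s'_def pop_def cell_exp_def top)
  have mem': "mem_ok st (snd s)"
    using mem by (rule mem_ok_append)
  have "conf i st ((fst s)(''top'' := ?t), snd s)"
    by (rule confI) (use confD[OF conf] mem' in \<open>simp_all del: valid.simps\<close>)
  then show "conf i st s'"
    unfolding s' using valid_bounds[OF val]
      conf_assign[of i st "((fst s)(''top'' := ?t), snd s)" "int r" "''r''"]
      conf_assign[of i st "((fst s)(''top'' := ?t, ''r'' := int r), snd s)" "int v" "''v''"]
      conf_assign[of i st "((fst s)(''top'' := ?t, ''r'' := int r, ''v'' := int v), snd s)" w "''w''"]
      conf_assign[of i st "((fst s)(''top'' := ?t, ''r'' := int r, ''v'' := int v, ''w'' := w), snd s)" "of_bool p" "''p''"]
    by simp
  show "fst s' ''r'' = int r" "fst s' ''v'' = int v" "fst s' ''w'' = w"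
    "fst s' ''p'' = of_bool p" "fst s' ''out'' = fst s ''out''" "snd s' = snd s"
    unfolding s' by auto
qed

lemma ceval_load_digit:
  assumes "conf i st s" "i < 2 * n" "fst s ''r'' = int r" "k = int j"
  shows "ceval (load_digit y k) s = ((fst s)(y := int (Y i r j)), snd s)"
proof (cases "6 * r + j < d")
  case True
  have "i * d + (6 * r + j) < (i + 1) * d" using True by simp
  also have "\<dots> \<le> 2 * n * d" using assms(2) by (intro mult_right_mono) auto
  finally have "snd s (int (i * d + (6 * r + j))) = int (x (i * d + (6 * r + j)))"
    using confD(9)[OF assms(1)] unfolding mem_ok_def by blast
  then show ?thesis using assms(3,4) confD(3,7)[OF assms(1)] True by (simp add: load_digit_def Y_def)
next
  case False
  then show ?thesis using assms(3,4) confD(3,7)[OF assms(1)] by (simp add: load_digit_def Y_def)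
qed

lemma Y_le_V: "\<bar>int (Y i r j)\<bar> \<le> V"
  using Y_less[of i r j] m_le_V by simp

lemma ceval_load_block:
  assumes "conf i st s" "i < 2 * n" "fst s ''r'' = int r"
  defines "s' \<equiv> ceval load_block s"
  shows "conf i st s'" "regs r (nat (fst s ''v'')) (fst s ''w'') (Y i r) (fst s') \<longleftrightarrow> 0 \<le> fst s ''v''"
    "fst s' ''p'' = fst s ''p''" "fst s' ''out'' = fst s ''out''" "snd s' = snd s"
proof -
  have eq: "ceval (Seq (load_digit y k) c) s = ceval c ((fst s)(y := int (Y i r j)), snd s)"
    if "conf i st s" "fst s ''r'' = int r" "k = int j" for y k j c s
    using ceval_load_digit[OF that(1) assms(2) that(2,3)] by simp
  let ?s = "((fst s)(''y0'' := int (Y i r 0), ''y1'' := int (Y i r 1), ''y2'' := int (Y i r 2),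
    ''y3'' := int (Y i r 3), ''y4'' := int (Y i r 4), ''y5'' := int (Y i r 5)), snd s)"
  have conf: "conf i st ((fst s)(y := int (Y i r j)), snd s)"
    if "conf i st s" "y \<noteq> ''n''" "y \<noteq> ''d''" "y \<noteq> ''B''" "y \<noteq> ''M''" "y \<noteq> ''N''" "y \<noteq> ''i''" "y \<noteq> ''top''" for y j s
    using that(1) Y_le_V that(2-) by (rule conf_assign)
  have 0: "conf i st ((fst s)(''y0'' := int (Y i r 0)), snd s)"
    using conf[OF assms(1), of "''y0''"] by simp
  have 1: "conf i st ((fst s)(''y0'' := int (Y i r 0), ''y1'' := int (Y i r 1)), snd s)"
    using conf[OF 0, of "''y1''"] by simp
  have 2: "conf i st ((fst s)(''y0'' := int (Y i r 0), ''y1'' := int (Y i r 1), ''y2'' := int (Y i r 2)), snd s)"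
    using conf[OF 1, of "''y2''"] by simp
  have 3: "conf i st ((fst s)(''y0'' := int (Y i r 0), ''y1'' := int (Y i r 1), ''y2'' := int (Y i r 2),
    ''y3'' := int (Y i r 3)), snd s)"
    using conf[OF 2, of "''y3''"] by simp
  have 4: "conf i st ((fst s)(''y0'' := int (Y i r 0), ''y1'' := int (Y i r 1), ''y2'' := int (Y i r 2),
    ''y3'' := int (Y i r 3), ''y4'' := int (Y i r 4)), snd s)"
    using conf[OF 3, of "''y4''"] by simp
  have 5: "conf i st ?s"
    using conf[OF 4, of "''y5''"] by simp
  have "s' = ?s"
    unfolding s'_def load_block_def
    by (simp add: eq[OF assms(1,3), of 0 0] eq[OF 0, of 1 1] eq[OF 1, of 2 2] eq[OF 2, of 3 3]
      eq[OF 3, of 4 4] ceval_load_digit[OF 4 assms(2), of r 5 5] assms(3) del: ceval.simps(4) One_nat_def)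
  then show "conf i st s'" "regs r (nat (fst s ''v'')) (fst s ''w'') (Y i r) (fst s') \<longleftrightarrow> 0 \<le> fst s ''v''"
    "fst s' ''p'' = fst s ''p''" "fst s' ''out'' = fst s ''out''" "snd s' = snd s"
    using 5 assms(3) by (auto simp: regs_def)
qed

lemma conf_expand:
  assumes conf: "conf i st s" and i: "i < 2 * n" and val: "valid (Suc r, v, w, p)"
    and s: "fst s ''r'' = int (Suc r)" "fst s ''v'' = int v" "fst s ''w'' = w" "fst s ''p'' = of_bool p"
  defines "s' \<equiv> ceval (expand m) s"
  shows "conf i (st @ children i (Suc r, v, w, p)) s' \<and> fst s' ''out'' = fst s ''out'' \<and>
    (\<forall>k\<ge>0. snd s' k = snd s k)"
proof -
  define w' where "w' = w * phase i r mod M"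
  have w': "0 \<le> w'" "w' < M" using M_ge by (auto simp: w'_def)
  have child: "valid (r, v * K + a, c mod M, q)" if "a < K" for a q c
    using val that M_ge by (intro valid_child) auto
  have val0: "valid (r, v * K, w', p)"
    using child[of 0 "w * phase i r" p] by (simp add: w'_def K_def)
  have bnd: "int r \<le> V" "int (v * K) \<le> V" "\<bar>w'\<bar> \<le> V"
    using valid_bounds[OF val0] by auto
  define s1 where "s1 = ((fst s)(''r'' := int r), snd s)"
  have conf1: "conf i st s1"
    unfolding s1_def using conf bnd by (intro conf_assign) auto
  define s2 where "s2 = ceval load_block s1"
  have s2: "conf i st s2" "regs r v w (Y i r) (fst s2)" "fst s2 ''p'' = of_bool p"
    "fst s2 ''out'' = fst s ''out''" "snd s2 = snd s"
    using ceval_load_block[OF conf1 i, of r] s by (auto simp: s2_def s1_def)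
  define s3 where "s3 = ((fst s2)(''w'' := w', ''v'' := int (v * K)), snd s2)"
  have "conf i st ((fst s2)(''w'' := w'), snd s2)"
    using s2(1) bnd by (intro conf_assign) auto
  then have conf3: "conf i st s3"
    using conf_assign[of i st "((fst s2)(''w'' := w'), snd s2)" "int (v * K)" "''v''"] bnd
    by (simp add: s3_def)
  have regs3: "regs r (v * K) w' (Y i r) (fst s3)"
    using s2(2) by (simp add: regs_def s3_def)
  have s3: "fst s3 ''p'' = of_bool p" "fst s3 ''out'' = fst s ''out''" "snd s3 = snd s"
    using s2 by (auto simp: s3_def)
  define c where "c = push (Reg ''r'') (Reg ''v'') (Reg ''w'') (Reg ''p'')"
  define s4 where "s4 = ceval c s3"
  have s4: "conf i (st @ [(r, v * K, w', p)]) s4 \<and> fst s4 = (fst s3)(''top'' := int (length st) + 1)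
    \<and> (\<forall>k\<ge>0. snd s4 k = snd s3 k)"
    unfolding s4_def c_def
    by (intro conf_push conf3 val0) (use regs3 s3 in \<open>auto simp: regs_def\<close>)
  then have regs4: "regs r (v * K) w' (Y i r) (fst s4)" and p4: "fst s4 ''p'' = of_bool p"
    and out4: "fst s4 ''out'' = fst s ''out''" and mem4: "\<forall>k\<ge>0. snd s4 k = snd s k"
    and conf4: "conf i (st @ [(r, v * K, w', p)]) s4"
    using regs3 s3 by (auto simp: regs_def)
  have "(m - 1) * quad (Y i r) mod m < m" using m_pos by simp
  then have "aval (char_exp m (quad_exp m)) s2 = phase i r"
    using aval_char_exp[OF aval_quad_exp[OF s2(2)]] confD(4)[OF s2(1)] by (simp add: phase_def)
  moreover have "fst s2 ''w'' = w" "fst s2 ''v'' = int v" "fst s2 ''M'' = M"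
    using s2(2) confD(5)[OF s2(1)] by (simp_all add: regs_def)
  ultimately have X: "aval (char_exp m (quad_exp m)) s2 = phase i r" "fst s2 ''w'' = w"
    "fst s2 ''v'' = int v" "fst s2 ''M'' = M" by blast+
  have s': "s' = ceval (Cond (Eq (Reg ''p'') (Const 0))
       (push (Reg ''r'') (Add (Reg ''v'') (Add (Const 1) (encode_exp m))) (Reg ''w'') (Const 1))
       (stars m [0..<m ^ 6])) s4"
  proof -
    have "ceval (Assign ''r'' (Sub (Reg ''r'') (Const 1))) s = s1"
      using s(1) by (simp add: s1_def)
    moreover have "ceval (Seq (Assign ''w'' (Mod (Mul (Reg ''w'') (char_exp m (quad_exp m))) (Reg ''M'')))
        (Assign ''v'' (Mul (Reg ''v'') (Const (int (m ^ 6 + 1)))))) s2 = s3"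
      using X by (simp add: s3_def w'_def K_def distrib_left)
    ultimately show ?thesis
      by (simp only: s'_def expand_def ceval.simps(4) s2_def[symmetric] s4_def c_def)
  qed
  show ?thesis
  proof (cases p)
    case True
    have "conf i ((st @ [(r, v * K, w', p)]) @ map (star_entry r (v * K) w' (Y i r))
        (filter (\<lambda>z. bent m (Y i r) (digit m z) \<noteq> 0) [0..<m ^ 6])) (ceval (stars m [0..<m ^ 6]) s4) \<and>
      (\<forall>k. k \<noteq> ''top'' \<longrightarrow> fst (ceval (stars m [0..<m ^ 6]) s4) k = fst s4 k) \<and>
      (\<forall>k\<ge>0. snd (ceval (stars m [0..<m ^ 6]) s4) k = snd s4 k)"
    proof (intro conf_stars conf4 regs4)
      fix z assume "z \<in> set [0..<m ^ 6]"
      then have "1 + z < K" by (simp add: K_def)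
      then show "valid (star_entry r (v * K) w' (Y i r) z)"
        unfolding star_entry_def by (rule child)
    qed
    then show ?thesis
      using True p4 out4 mem4 by (simp add: s' Let_def w'_def)
  next
    case False
    let ?e = "(r, v * K + (1 + encode m (Y i r)), w', True)"
    let ?c = "push (Reg ''r'') (Add (Reg ''v'') (Add (Const 1) (encode_exp m))) (Reg ''w'') (Const 1)"
    have "conf i ((st @ [(r, v * K, w', p)]) @ [?e]) (ceval ?c s4) \<and>
      fst (ceval ?c s4) = (fst s4)(''top'' := int (length (st @ [(r, v * K, w', p)])) + 1) \<and>
      (\<forall>k\<ge>0. snd (ceval ?c s4) k = snd s4 k)"
    proof (intro conf_push conf4)
      show "valid ?e" using encode_Y_less unfolding w'_def by (intro child) (simp add: K_def)
      show "aval (Add (Reg ''v'') (Add (Const 1) (encode_exp m))) (fst s4, \<mu>) = int (v * K + (1 + encode m (Y i r)))" for \<mu>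
        using aval_encode_exp[of r "v * K" w' "Y i r" "(fst s4, \<mu>)"] regs4 by (simp add: regs_def)
    qed (use regs4 in \<open>auto simp: regs_def\<close>)
    then show ?thesis
      using False p4 out4 mem4 by (simp add: s' Let_def w'_def)
  qed
qed

definition table :: "state \<Rightarrow> nat \<Rightarrow> int" where
  "table s v = snd s (int (2 * n * d + v))"

lemma conf_leaf:
  assumes conf: "conf i st s"
    and s: "fst s ''v'' = int v" "fst s ''w'' = w"
  defines "s' \<equiv> ceval leaf s"
  shows "conf i st s'"
    "i < n \<Longrightarrow> table s' = (table s)(v := (table s v + w) mod M) \<and> fst s' ''out'' = fst s ''out''"
    "n \<le> i \<Longrightarrow> table s' = table s \<and> fst s' ''out'' = (fst s ''out'' + table s v * w) mod M"
proof -
  have nd: "fst s ''n'' = int n" "fst s ''d'' = int d" "fst s ''M'' = M" "fst s ''i'' = int i"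
    using confD[OF conf] by blast+
  have addr: "aval table_exp s = int (2 * n * d + v)"
    using s nd by (simp add: table_exp_def)
  have M: "\<bar>c mod M\<bar> \<le> V" for c
    using M_ge M_less_V pos_mod_bound[of M c] pos_mod_sign[of M c] by linarith
  have "conf i st s' \<and> (i < n \<longrightarrow> table s' = (table s)(v := (table s v + w) mod M) \<and> fst s' ''out'' = fst s ''out'') \<and>
    (n \<le> i \<longrightarrow> table s' = table s \<and> fst s' ''out'' = (fst s ''out'' + table s v * w) mod M)"
  proof (cases "i < n")
    case True
    have s': "s' = (fst s, (snd s)(int (2 * n * d + v) := (table s v + w) mod M))"
      using True nd s by (simp add: s'_def leaf_def addr table_def)
    have "mem_ok st (snd s')"
      unfolding s' snd_conv by (intro mem_ok_upd confD(9)[OF conf] M) simp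
    then have "conf i st s'"
      by (intro confI) (use confD[OF conf] in \<open>simp_all add: s' del: valid.simps\<close>)
    then show ?thesis using True by (simp add: s' table_def fun_eq_iff)
  next
    case False
    have s': "s' = ((fst s)(''out'' := (fst s ''out'' + table s v * w) mod M), snd s)"
      using False nd s by (simp add: s'_def leaf_def addr table_def)
    show ?thesis using False conf_assign[OF conf, of _ "''out''"] M unfolding s' by (auto simp: table_def)
  qed
  then show "conf i st s'"
    "i < n \<Longrightarrow> table s' = (table s)(v := (table s v + w) mod M) \<and> fst s' ''out'' = fst s ''out''"
    "n \<le> i \<Longrightarrow> table s' = table s \<and> fst s' ''out'' = (fst s ''out'' + table s v * w) mod M"
    by auto
qed

lemma table_cong: "(\<And>k. 0 \<le> k \<Longrightarrow> snd s' k = snd s k) \<Longrightarrow> table s' = table s"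
  by (intro ext) (simp add: table_def)

lemma conf_process:
  assumes conf: "conf i (st @ [(r, v, w, p)]) s" and i: "i < 2 * n"
  defines "s' \<equiv> ceval (process m) s"
  shows "conf i (st @ children i (r, v, w, p)) s'"
    "0 < r \<Longrightarrow> table s' = table s \<and> fst s' ''out'' = fst s ''out''"
    "r = 0 \<Longrightarrow> i < n \<Longrightarrow> table s' = (table s)(v := (table s v + w) mod M) \<and> fst s' ''out'' = fst s ''out''"
    "r = 0 \<Longrightarrow> n \<le> i \<Longrightarrow> table s' = table s \<and> fst s' ''out'' = (fst s ''out'' + table s v * w) mod M"
proof -
  note pop = conf_pop[OF conf]
  let ?s = "ceval pop s"
  have tab: "table ?s = table s" using pop(7) by (intro ext) (simp add: table_def)
  have val: "valid (r, v, w, p)" using confD(10)[OF conf, of "(r, v, w, p)"] by simp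
  have "conf i (st @ children i (r, v, w, p)) s' \<and>
    (0 < r \<longrightarrow> table s' = table s \<and> fst s' ''out'' = fst s ''out'') \<and>
    (r = 0 \<longrightarrow> (i < n \<longrightarrow> table s' = (table s)(v := (table s v + w) mod M) \<and> fst s' ''out'' = fst s ''out'') \<and>
      (n \<le> i \<longrightarrow> table s' = table s \<and> fst s' ''out'' = (fst s ''out'' + table s v * w) mod M))"
  proof (cases r)
    case 0
    then have "s' = ceval leaf ?s" using pop(2) by (simp add: s'_def process_def)
    then show ?thesis using conf_leaf[OF pop(1,3,4)] 0 pop(6) tab by simp
  next
    case (Suc r')
    then have s': "s' = ceval (expand m) ?s" using pop(2) by (simp add: s'_def process_def)
    have "conf i (st @ children i (Suc r', v, w, p)) s' \<and> fst s' ''out'' = fst ?s ''out'' \<and>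
        (\<forall>k\<ge>0. snd s' k = snd ?s k)"
      unfolding s' by (rule conf_expand) (use pop val i Suc in auto)
    then show ?thesis using Suc pop(6) tab table_cong[of s' ?s] by simp
  qed
  then show "conf i (st @ children i (r, v, w, p)) s'"
    "0 < r \<Longrightarrow> table s' = table s \<and> fst s' ''out'' = fst s ''out''"
    "r = 0 \<Longrightarrow> i < n \<Longrightarrow> table s' = (table s)(v := (table s v + w) mod M) \<and> fst s' ''out'' = fst s ''out''"
    "r = 0 \<Longrightarrow> n \<le> i \<Longrightarrow> table s' = table s \<and> fst s' ''out'' = (fst s ''out'' + table s v * w) mod M"
    by auto
qed

definition root_entry :: "nat \<Rightarrow> entry" where
  "root_entry i = (N, 0, 1, n \<le> i)"

lemma valid_root: "valid (root_entry i)"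
  using M_ge by (simp add: root_entry_def)

lemma conf_push_root:
  assumes conf: "conf i [] s"
  defines "s' \<equiv> ceval push_root s"
  shows "conf i [root_entry i] s'" "table s' = table s" "fst s' ''out'' = fst s ''out''"
proof -
  have *: "fst s ''N'' = int N" "fst s ''n'' = int n" "fst s ''i'' = int i"
    using confD[OF conf] by blast+
  let ?c = "push (Reg ''N'') (Const 0) (Const 1) (Const (of_bool (n \<le> i)))"
  have s': "s' = ceval ?c s"
    using * by (auto simp: s'_def push_root_def)
  have "conf i ([] @ [(N, 0, 1, n \<le> i)]) (ceval ?c s) \<and>
    fst (ceval ?c s) = (fst s)(''top'' := int (length ([] :: entry list)) + 1) \<and> (\<forall>k\<ge>0. snd (ceval ?c s) k = snd s k)"
    by (intro conf_push conf) (use * valid_root[of i] in \<open>auto simp: root_entry_def simp del: valid.simps\<close>)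
  then show "conf i [root_entry i] s'" "table s' = table s" "fst s' ''out'' = fst s ''out''"
    unfolding s' by (auto simp: root_entry_def intro!: table_cong)
qed

end

section \<open>The invariant of the main loop\<close>

lemma sum_list_filter_upt:
  fixes f :: "nat \<Rightarrow> 'a :: comm_monoid_add"
  assumes "\<And>z. z < k \<Longrightarrow> \<not> P z \<Longrightarrow> f z = 0"
  shows "sum_list (map f (filter P [0..<k])) = (\<Sum>z<k. f z)"
proof -
  have "sum_list (map f (filter P [0..<k])) = sum_list (map f [0..<k])"
    using assms by (intro sum_list_map_filter) auto
  then show ?thesis by (simp add: interv_sum_list_conv_sum_set_nat atLeast0LessThan)
qed

lemma sum_list_zero: "(\<And>x. x \<in> set xs \<Longrightarrow> x = 0) \<Longrightarrow> sum_list xs = (0 :: 'a :: monoid_add)"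
  by (induction xs) auto

lemma length_filter_upt: "length (filter P [0..<k]) = card {z. z < k \<and> P z}"
proof -
  have "length (filter P [0..<k]) = card (set (filter P [0..<k]))"
    by (simp only: distinct_card[symmetric] distinct_filter distinct_upt)
  also have "set (filter P [0..<k]) = {z. z < k \<and> P z}" by auto
  finally show ?thesis .
qed

text \<open>This estimate serves only to keep the stack height below \<open>V\<close>, where a
  constant factor in the exponent just changes bit lengths by a constant factor. The running time
  rests on the sharper bound with base \<open>1 + sqrt S\<close>.\<close>

lemma work_le:
  assumes "1 \<le> S"
  shows "work S r p \<le> (S + 2) ^ r"
proof (induction r arbitrary: p)
  case (Suc r)
  define P where "P = (S + 2) ^ r"
  have "1 \<le> P" by (simp add: P_def)
  have IH: "work S r q \<le> P" for q using Suc.IH by (simp add: P_def)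
  have "work S (Suc r) p \<le> P + P + S * P"
  proof (cases p)
    case True
    have "1 + work S r True + S * work S r False \<le> P + P + S * P"
      by (intro add_mono mult_le_mono2 IH \<open>1 \<le> P\<close>)
    then show ?thesis using True by simp
  next
    case False
    have "1 + work S r False + work S r True \<le> P + P + P"
      by (intro add_mono IH \<open>1 \<le> P\<close>)
    also have "\<dots> \<le> P + P + S * P" using assms by simp
    finally show ?thesis using False by simp
  qed
  also have "\<dots> = (S + 2) ^ Suc r" by (simp add: P_def algebra_simps)
  finally show ?case .
qed simp

context ov_machine
begin

section \<open>Conservation laws and the decreasing potential\<close>

fun ent :: "(nat \<Rightarrow> int) \<Rightarrow> nat \<Rightarrow> entry \<Rightarrow> int" where
  "ent \<phi> i (r, v, w, p) = w * flow \<phi> i r v p"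

fun entry_work :: "entry \<Rightarrow> nat" where
  "entry_work (r, v, w, p) = work S r p"

text \<open>Conservation law: replacing an entry by its children preserves the total contribution
  modulo \<open>M\<close>. The stars that the program skips have coefficient
  \<open>B ^ 0 - 1 = 0\<close>.\<close>

lemma ent_children:
  "[sum_list (map (ent \<phi> i) (children i (Suc r, v, w, p))) = ent \<phi> i (Suc r, v, w, p)] (mod M)"
proof -
  define w' where "w' = w * phase i r mod M"
  have w': "[w' = w * phase i r] (mod M)" by (simp add: w'_def)
  show ?thesis
  proof (cases p)
    case True
    have eq: "sum_list (map (ent \<phi> i) (children i (Suc r, v, w, p)))
      = w' * flow \<phi> i r (v * K) True + (\<Sum>z<m ^ 6. w' * (B ^ bent m (Y i r) (digit m z) - 1) mod M * flow \<phi> i r (v * K + (1 + z)) False)"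
      using True sum_list_filter_upt[of "m ^ 6" "\<lambda>z. bent m (Y i r) (digit m z) \<noteq> 0"
        "ent \<phi> i \<circ> star_entry r (v * K) w' (Y i r)"]
      by (simp add: Let_def w'_def star_entry_def)
    have "[w' * flow \<phi> i r (v * K) True + (\<Sum>z<m ^ 6. w' * (B ^ bent m (Y i r) (digit m z) - 1) mod M * flow \<phi> i r (v * K + (1 + z)) False)
      = w * phase i r * flow \<phi> i r (v * K) True + (\<Sum>z<m ^ 6. w * phase i r * (B ^ bent m (Y i r) (digit m z) - 1) * flow \<phi> i r (v * K + (1 + z)) False)] (mod M)"
    proof (intro cong_add cong_sum cong_mult w')
      fix z
      have "[w' * (B ^ bent m (Y i r) (digit m z) - 1) = w * phase i r * (B ^ bent m (Y i r) (digit m z) - 1)] (mod M)"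
        by (intro cong_mult w') simp
      then show "[w' * (B ^ bent m (Y i r) (digit m z) - 1) mod M = w * phase i r * (B ^ bent m (Y i r) (digit m z) - 1)] (mod M)"
        by simp
    qed simp_all
    then show ?thesis unfolding eq using True by (simp add: distrib_left sum_distrib_left mult.assoc)
  next
    case False
    have eq: "sum_list (map (ent \<phi> i) (children i (Suc r, v, w, p)))
      = w' * flow \<phi> i r (v * K) False + w' * flow \<phi> i r (v * K + (1 + encode m (Y i r))) True"
      using False by (simp add: Let_def w'_def)
    have "[w' * flow \<phi> i r (v * K) False + w' * flow \<phi> i r (v * K + (1 + encode m (Y i r))) True
      = w * phase i r * flow \<phi> i r (v * K) False + w * phase i r * flow \<phi> i r (v * K + (1 + encode m (Y i r))) True] (mod M)"
      by (intro cong_add cong_mult w') simp_all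
    then show ?thesis unfolding eq using False by (simp add: distrib_left mult.assoc)
  qed
qed

lemma entry_work_children:
  "sum_list (map entry_work (children i e)) < entry_work e"
proof (cases e)
  case (fields r v w p)
  show ?thesis
  proof (cases r)
    case (Suc r')
    have "length (filter (\<lambda>z. bent m (Y i r') (digit m z) \<noteq> 0) [0..<m ^ 6]) * work S r' False \<le> S * work S r' False"
      unfolding length_filter_upt by (intro mult_right_mono S_bent) simp
    moreover have "sum_list (map (entry_work \<circ> star_entry r' v' w' y) zs) = length zs * work S r' False"
      for v' w' y zs
      by (induction zs) (simp_all add: star_entry_def)
    ultimately show ?thesis
      using Suc fields by (simp add: Let_def less_Suc_eq_le del: mult_le_cancel2)
  qed (simp add: fields)
qed

text \<open>The stack followed by the root entries of all later vectors: moving on to the next vector leaves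
  this list unchanged.\<close>

definition schedule :: "nat \<Rightarrow> entry list \<Rightarrow> (nat \<times> entry) list" where
  "schedule i st = (if i < 2 * n then map (Pair i) st else []) @ map (\<lambda>i'. (i', root_entry i')) [Suc i..<2 * n]"

definition pending :: "(nat \<Rightarrow> entry \<Rightarrow> 'a) \<Rightarrow> (nat \<times> entry) list \<Rightarrow> 'a :: comm_monoid_add" where
  "pending f L = sum_list (map (\<lambda>(i, e). f i e) L)"

text \<open>For \<open>i = 2 * n - 1\<close> the root that gets pushed belongs to no vector;
  \<open>schedule\<close> ignores the stack from \<open>2 * n\<close> on, so the equation holds
  there too and the stack is nonempty at every loop head.\<close>

lemma schedule_next: "i < 2 * n \<Longrightarrow> schedule (Suc i) [root_entry (Suc i)] = schedule i []"
  by (cases "Suc i < 2 * n") (auto simp: schedule_def upt_conv_Cons)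

lemma pending_schedule_append:
  "i < 2 * n \<Longrightarrow> pending f (schedule i (st @ es)) = sum_list (map (f i) es) + pending f (schedule i st)"
  by (simp add: pending_def schedule_def comp_def add_ac)

lemma pending_schedule_root: "pending f (schedule 0 [root_entry 0]) = (\<Sum>i<2 * n. f i (root_entry i))"
proof -
  have "schedule 0 [root_entry 0] = map (\<lambda>i'. (i', root_entry i')) (0 # [Suc 0..<2 * n])"
    using n_ge1 by (simp add: schedule_def)
  also have "0 # [Suc 0..<2 * n] = [0..<2 * n]"
    using n_ge1 by (simp add: upt_conv_Cons)
  finally show ?thesis
    by (simp add: pending_def comp_def interv_sum_list_conv_sum_set_nat atLeast0LessThan)
qed

definition table_share :: "nat \<Rightarrow> nat \<Rightarrow> entry \<Rightarrow> int" where
  "table_share v i e = (if i < n then ent (\<lambda>u. of_bool (u = v)) i e else 0)"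

definition final_table :: "nat \<Rightarrow> int" where
  "final_table v = (\<Sum>i<2 * n. table_share v i (root_entry i))"

text \<open>The share is defined with the completed table rather than the current one, so that the
  total to be reached is fixed from the start. This is sound because shares are collected only after
  the last vector of the first group is finished.\<close>

definition out_share :: "nat \<Rightarrow> entry \<Rightarrow> int" where
  "out_share i e = (if i < n then 0 else ent final_table i e)"

lemma pending_table_share_zero: "n \<le> i \<Longrightarrow> pending (table_share v) (schedule i st) = 0"
  unfolding pending_def schedule_def by (intro sum_list_zero) (auto simp: table_share_def)

text \<open>Both sums have the form "accumulated plus still pending equals final", modulo
  \<open>M\<close>. The index \<open>k\<close>, the pending work, is the termination measure and
  also controls the stack height.\<close>

definition loop_inv :: "nat \<Rightarrow> state \<Rightarrow> bool" where
  "loop_inv k s \<longleftrightarrow> (\<exists>i st. conf i st s \<and> i \<le> 2 * n \<and> st \<noteq> [] \<and> int (length st) \<le> V \<and>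
     (\<forall>v. [table s v + pending (table_share v) (schedule i st) = final_table v] (mod M)) \<and>
     [fst s ''out'' + pending out_share (schedule i st) = (\<Sum>i<2 * n. out_share i (root_entry i))] (mod M) \<and>
     k = pending (\<lambda>_. entry_work) (schedule i st) \<and> k \<le> 2 * n * (m ^ 6 + 2) ^ N)"

lemma length_le_work: "length st \<le> sum_list (map entry_work st)"
proof (induction st)
  case (Cons e st)
  obtain r v w p where "e = (r, v, w, p)" by (cases e)
  then show ?case using Cons work_pos[of S r p] by simp
qed simp

lemma length_le_V:
  assumes "i < 2 * n" "pending (\<lambda>_. entry_work) (schedule i st) \<le> 2 * n * (m ^ 6 + 2) ^ N"
  shows "int (length st) \<le> V"
proof -
  have "length st \<le> pending (\<lambda>_. entry_work) (schedule i st)"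
    using pending_schedule_append[OF assms(1), of "\<lambda>_. entry_work" "[]" st] length_le_work[of st] by simp
  also note assms(2)
  finally have "int (length st) \<le> int (2 * n * (m ^ 6 + 2) ^ N)" by linarith
  also have "\<dots> = 2 * int n * (int m ^ 6 + 2) ^ N" by (simp add: add.commute)
  also have "\<dots> \<le> V" using two_n_le_B N_le by (intro power_le_V) auto
  finally show ?thesis .
qed

lemma conf_next_vector:
  assumes "conf i st s" "i < 2 * n"
  defines "s' \<equiv> ceval next_vector s"
  shows "table s' = table s \<and> fst s' ''out'' = fst s ''out'' \<and>
    (\<exists>i' st'. conf i' st' s' \<and> i' \<le> 2 * n \<and> st' \<noteq> [] \<and> schedule i' st' = schedule i st \<and>
      (st' = st \<and> i' = i \<or> length st' = 1))"
proof (cases "st = []")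
  case False
  then have "s' = s" using confD(8)[OF assms(1)] by (simp add: s'_def next_vector_def)
  then show ?thesis
    using assms(1,2) False by (intro conjI exI[of _ i] exI[of _ st]) simp_all
next
  case True
  define s1 where "s1 = ((fst s)(''i'' := int (Suc i)), snd s)"
  have "s' = ceval push_root s1"
    using confD(7,8)[OF assms(1)] True by (simp add: s'_def s1_def next_vector_def add.commute)
  moreover have "int (Suc i) \<le> V" using two_n_le_B B_le_V[of 1] assms(2) by simp
  then have "conf (Suc i) [] s1"
    by (intro confI) (use confD[OF assms(1)] True in \<open>simp_all add: s1_def del: valid.simps\<close>)
  moreover have "table s1 = table s" "fst s1 ''out'' = fst s ''out''"
    by (auto simp: s1_def table_def)
  ultimately show ?thesis
    using conf_push_root[of "Suc i" s1] assms(2) True schedule_next[OF assms(2)]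
    by (intro conjI exI[of _ "Suc i"] exI[of _ "[root_entry (Suc i)]"]) auto
qed

lemma loop_inv_body:
  assumes "loop_inv k s" "bval guard s"
  shows "\<exists>k'<k. loop_inv k' (ceval (body m) s)"
proof -
  obtain i st0 where st0: "conf i st0 s" "i \<le> 2 * n" "st0 \<noteq> []"
     "\<And>v. [table s v + pending (table_share v) (schedule i st0) = final_table v] (mod M)"
     "[fst s ''out'' + pending out_share (schedule i st0) = (\<Sum>i<2 * n. out_share i (root_entry i))] (mod M)"
     "k = pending (\<lambda>_. entry_work) (schedule i st0)" "k \<le> 2 * n * (m ^ 6 + 2) ^ N"
    using assms(1) unfolding loop_inv_def by blast
  have i: "i < 2 * n" using assms(2) confD(2,7)[OF st0(1)] by (simp add: guard_def)
  obtain st e where e: "st0 = st @ [e]" using st0(3) by (cases st0 rule: rev_cases) auto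
  obtain r v w p where rvwp: "e = (r, v, w, p)" by (cases e)
  define s1 where "s1 = ceval (process m) s"
  have "conf i (st @ [(r, v, w, p)]) s" using st0(1) e rvwp by simp
  note proc = conf_process[OF this i, folded s1_def]
  let ?st = "st @ children i e"
  have tU: "pending (table_share u) (schedule i ?st) = sum_list (map (table_share u i) (children i e)) + pending (table_share u) (schedule i st)"
    "pending (table_share u) (schedule i st0) = table_share u i e + pending (table_share u) (schedule i st)" for u
    unfolding e pending_schedule_append[OF i] by auto
  have tV: "pending out_share (schedule i ?st) = sum_list (map (out_share i) (children i e)) + pending out_share (schedule i st)"
    "pending out_share (schedule i st0) = out_share i e + pending out_share (schedule i st)"
    unfolding e pending_schedule_append[OF i] by auto
  have table: "[table s1 u + pending (table_share u) (schedule i ?st) = final_table u] (mod M)" for u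
  proof -
    have "[table s1 u + sum_list (map (table_share u i) (children i e)) = table s u + table_share u i e] (mod M)"
    proof (cases "i < n")
      case True
      show ?thesis
      proof (cases r)
        case 0
        then show ?thesis using proc(3) True by (simp add: rvwp table_share_def cong_def)
      next
        case (Suc r')
        then show ?thesis using proc(2) True ent_children[of "\<lambda>u'. of_bool (u' = u)" i r' v w p]
          by (simp add: rvwp table_share_def[abs_def] cong_add_lcancel del: children.simps ent.simps)
      qed
    next
      case False
      then show ?thesis using proc(2,4) by (cases r) (simp_all add: table_share_def[abs_def] sum_list_triv)
    qed
    then have "[table s1 u + pending (table_share u) (schedule i ?st) = table s u + pending (table_share u) (schedule i st0)] (mod M)"
      unfolding tU using cong_add[OF _ cong_refl[of "pending (table_share u) (schedule i st)" M]] by (fastforce simp: add.assoc)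
    then show ?thesis using st0(4) cong_trans by blast
  qed
  have out: "[fst s1 ''out'' + pending out_share (schedule i ?st) = (\<Sum>i<2 * n. out_share i (root_entry i))] (mod M)"
  proof -
    have "[fst s1 ''out'' + sum_list (map (out_share i) (children i e)) = fst s ''out'' + out_share i e] (mod M)"
    proof (cases "i < n")
      case True
      then show ?thesis using proc(2,3) by (cases r) (simp_all add: out_share_def[abs_def] sum_list_triv)
    next
      case False
      show ?thesis
      proof (cases r)
        case 0
        \<comment> \<open>For \<open>n \<le> i\<close> no deposit is pending any more, so the table
          is already complete.\<close>
        have "[table s v = final_table v] (mod M)"
          using st0(4)[of v] False by (simp add: pending_table_share_zero)
        then have "[fst s ''out'' + table s v * w = fst s ''out'' + w * final_table v] (mod M)"
          by (subst mult.commute[of w], intro cong_add cong_mult) simp_all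
        then show ?thesis using 0 proc(4) False by (simp add: rvwp out_share_def)
      next
        case (Suc r')
        then show ?thesis using proc(2) False ent_children[of final_table i r' v w p]
          by (simp add: rvwp out_share_def[abs_def] cong_add_lcancel del: children.simps ent.simps)
      qed
    qed
    then have "[fst s1 ''out'' + pending out_share (schedule i ?st) = fst s ''out'' + pending out_share (schedule i st0)] (mod M)"
      unfolding tV using cong_add[OF _ cong_refl[of "pending out_share (schedule i st)" M]] by (fastforce simp: add.assoc)
    then show ?thesis using st0(5) cong_trans by blast
  qed
  define k' where "k' = pending (\<lambda>_. entry_work) (schedule i ?st)"
  have k': "k' < k"
    using entry_work_children[of i e] unfolding k'_def st0(6) e pending_schedule_append[OF i] by simp
  define s2 where "s2 = ceval next_vector s1"
  have body: "ceval (body m) s = s2" by (simp add: body_def s1_def s2_def)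
  have "conf i ?st s1" using proc(1) by (simp add: rvwp)
  from conf_next_vector[OF this i, folded s2_def] obtain i' st' where
    next_vector: "table s2 = table s1" "fst s2 ''out'' = fst s1 ''out''" "conf i' st' s2" "i' \<le> 2 * n" "st' \<noteq> []"
      "schedule i' st' = schedule i ?st" "st' = ?st \<and> i' = i \<or> length st' = 1"
    by blast
  have "int (length st') \<le> V"
  proof (cases "length st' = 1")
    case True
    then show ?thesis using one_less_V by simp
  next
    case False
    have "pending (\<lambda>_. entry_work) (schedule i ?st) \<le> 2 * n * (m ^ 6 + 2) ^ N"
      using k' st0(7) by (simp add: k'_def)
    then have "int (length ?st) \<le> V" by (rule length_le_V[OF i])
    then show ?thesis using next_vector(7) False by auto
  qed
  then have "loop_inv k' s2"
    unfolding loop_inv_def using next_vector table out k' st0(7)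
    by (intro exI[of _ i'] exI[of _ st']) (simp add: k'_def)
  then show ?thesis using k' body by auto
qed

lemma loop_inv_bounded:
  assumes "loop_inv k s" shows "bounded (len V) s"
proof -
  obtain i st where st: "conf i st s" "int (length st) \<le> V" using assms unfolding loop_inv_def by blast
  have "\<bar>fst s y\<bar> \<le> \<bar>V\<bar>" for y
    using st(2) confD(1,8)[OF st(1)] one_less_V by (cases "y = ''top''") auto
  moreover have "\<bar>snd s a\<bar> \<le> \<bar>V\<bar>" for a
    using confD(9)[OF st(1)] abs_ge_self[of V] unfolding mem_ok_def by (meson order_trans)
  ultimately show ?thesis unfolding bounded_def using len_mono by blast
qed

lemma loop_inv_final:
  assumes "loop_inv k s" "\<not> bval guard s"
  shows "[fst s ''out'' = (\<Sum>i<2 * n. out_share i (root_entry i))] (mod M)" "fst s ''M'' = M" "fst s ''B'' = B"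
proof -
  obtain i st where st: "conf i st s" "i \<le> 2 * n"
     "[fst s ''out'' + pending out_share (schedule i st) = (\<Sum>i<2 * n. out_share i (root_entry i))] (mod M)"
    using assms unfolding loop_inv_def by blast
  have "i = 2 * n" using st(2) assms(2) confD(2,7)[OF st(1)] by (simp add: guard_def)
  then show "[fst s ''out'' = (\<Sum>i<2 * n. out_share i (root_entry i))] (mod M)"
    using st(3) by (simp add: schedule_def pending_def)
  show "fst s ''M'' = M" "fst s ''B'' = B" using confD(4,5)[OF st(1)] by simp_all
qed

definition start :: state where
  "start = ((\<lambda>_. 0)(''n'' := int n, ''d'' := int d),
     (\<lambda>a. if 0 \<le> a \<and> a < int (2 * n * d) then int (x (nat a)) else 0))"

lemma start_bounded: "bounded (len V) start"
proof -
  have "int n \<le> V" using two_n_le_B B_le_V[of 1] by simp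
  then have "\<bar>fst start y\<bar> \<le> \<bar>V\<bar>" for y using d_le_V one_less_V by (auto simp: start_def)
  moreover have "int (x k) \<le> V" for k using x_less[of k] m_le_V by linarith
  then have "\<bar>snd start a\<bar> \<le> \<bar>V\<bar>" for a using one_less_V by (auto simp: start_def)
  ultimately show ?thesis unfolding bounded_def using len_mono by blast
qed

lemma loop_inv_init:
  assumes "\<And>r p. work S r p \<le> (m ^ 6 + 2) ^ r"
  shows "\<exists>k\<le>2 * n * work S N True. loop_inv k (ceval (init m) start)"
proof -
  define s where "s = ((fst start)(''B'' := B, ''M'' := M, ''N'' := int N), snd start)"
  have init: "ceval (init m) start = ceval push_root s"
    by (simp add: init_def s_def start_def B_def M_def N_def zdiv_int fun_upd_twist)
  have "int n \<le> V" "B \<le> V" "\<bar>B\<bar> \<le> V" using two_n_le_B B_le_V[of 1] B_ge by simp_all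
  moreover have "\<bar>M\<bar> \<le> V" using M_less_V M_ge by simp
  moreover have "int N \<le> V" using N_le d_le_V by simp
  moreover have "int (x k) \<le> V" for k using x_less[of k] m_le_V by linarith
  moreover have "mem_ok [] (snd s)"
    using \<open>\<And>k. int (x k) \<le> V\<close> one_less_V
    by (intro mem_okI) (simp_all add: s_def start_def del: of_nat_mult)
  ultimately have "conf 0 [] s"
    by (intro confI) (use d_le_V one_less_V in \<open>simp_all add: s_def start_def\<close>)
  note root_entry = conf_push_root[OF this]
  have zero: "table s v = 0" "fst s ''out'' = 0" for v
    by (auto simp: table_def s_def start_def)
  let ?k = "pending (\<lambda>_. entry_work) (schedule 0 [root_entry 0])"
  have k: "?k = (\<Sum>i<2 * n. work S N (n \<le> i))"
    unfolding pending_schedule_root by (simp add: root_entry_def)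
  also have "\<dots> \<le> (\<Sum>i<2 * n. work S N True)"
  proof (intro sum_mono)
    show "work S N (n \<le> i) \<le> work S N True" for i
      using work_mono[OF S_ge, of N] by (cases "n \<le> i") simp_all
  qed
  finally have k: "?k \<le> 2 * n * work S N True" by simp
  also have "\<dots> \<le> 2 * n * (m ^ 6 + 2) ^ N"
    by (intro mult_left_mono assms) simp
  finally have "loop_inv ?k (ceval (init m) start)"
    unfolding loop_inv_def init using root_entry zero one_less_V
    by (intro exI[of _ 0] exI[of _ "[root_entry 0]"])
      (auto simp: pending_schedule_root final_table_def)
  then show ?thesis using k by blast
qed

text \<open>Roots of the first group carry the flag \<open>False\<close> and those of the second
  \<open>True\<close>, the opposite flags that \<open>flow_flow\<close> asks for. Since
  \<open>flow\<close> is linear in its leaf function, pairing with the common table expands into the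
  double sum over pairs.\<close>

lemma final_value:
  "[(\<Sum>i<2 * n. out_share i (root_entry i)) = (\<Sum>j<n. \<Sum>i<n. B ^ (\<Sum>b<N. inner6 (Y i b) (Y (n + j) b)))] (mod M)"
proof -
  have ft: "final_table = (\<lambda>v. \<Sum>i<n. flow (\<lambda>u. of_bool (u = v)) i N 0 False)"
  proof
    fix v
    have "final_table v = (\<Sum>i<n. table_share v i (root_entry i))"
      unfolding final_table_def by (intro sum.mono_neutral_right) (auto simp: table_share_def)
    then show "final_table v = (\<Sum>i<n. flow (\<lambda>u. of_bool (u = v)) i N 0 False)"
      by (simp add: table_share_def root_entry_def)
  qed
  have "(\<Sum>i<2 * n. out_share i (root_entry i)) = (\<Sum>i\<in>{n..<2 * n}. out_share i (root_entry i))"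
    by (intro sum.mono_neutral_right) (auto simp: out_share_def)
  also have "\<dots> = (\<Sum>j<n. out_share (n + j) (root_entry (n + j)))"
    by (rule sum.reindex_bij_witness[of _ "\<lambda>j. n + j" "\<lambda>i. i - n"]) auto
  also have "\<dots> = (\<Sum>j<n. flow final_table (n + j) N 0 True)"
    by (simp add: out_share_def root_entry_def)
  also have "\<dots> = (\<Sum>j<n. \<Sum>i<n. flow (\<lambda>v. flow (\<lambda>u. of_bool (u = v)) i N 0 False) (n + j) N 0 True)"
    unfolding ft flow_sum ..
  finally have eq: "(\<Sum>i<2 * n. out_share i (root_entry i)) = \<dots>" .
  show ?thesis
    unfolding eq using flow_flow[of _ N 0 False] by (intro cong_sum) simp
qed

lemma inner6_blocks: "(\<Sum>b<N. inner6 (Y i b) (Y j b)) = (\<Sum>k<d. x (i * d + k) * x (j * d + k))"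
proof -
  let ?f = "\<lambda>t. if t < d then x (i * d + t) * x (j * d + t) else 0"
  have "inner6 (Y i b) (Y j b) = sum ?f {b * 6..<b * 6 + 6}" for b
  proof -
    have "inner6 (Y i b) (Y j b) = (\<Sum>k<6. ?f (6 * b + k))"
      unfolding inner6_def Y_def by (intro sum.cong) auto
    also have "\<dots> = sum ?f {b * 6..<b * 6 + 6}"
      by (rule sum.reindex_bij_witness[of _ "\<lambda>t. t - b * 6" "\<lambda>k. b * 6 + k"]) (auto simp: mult.commute)
    finally show ?thesis .
  qed
  then have "(\<Sum>b<N. inner6 (Y i b) (Y j b)) = sum ?f {..<N * 6}"
    by (simp add: sum.nat_group)
  also have "\<dots> = sum ?f {..<d}"
    by (intro sum.mono_neutral_right) (auto simp: N_def)
  finally show ?thesis by simp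
qed

text \<open>The constants \<open>K1\<close>, \<open>K2\<close>, \<open>K3\<close> and
  \<open>H\<close> enter as hypotheses so that they can be chosen from the program alone, before
  \<open>n\<close>, \<open>d\<close> and the input; the final bound has to be uniform in
  these.\<close>

theorem exec_program:
  assumes K: "com_bound (init m) K1" "com_bound (body m) K2" "com_bound final K3"
    and H: "\<forall>s L. bounded L s \<longrightarrow> bcost guard s \<le> H * L\<^sup>2"
  shows "\<exists>t s. exec (program m) start t s \<and>
    fst s ''out'' = int (card {(i, j). i < n \<and> j < n \<and> (\<Sum>k<d. x (i * d + k) * x ((n + j) * d + k)) mod m = 0}) \<and>
    t \<le> (K1 + H + K2 + K3) * (len V)\<^sup>2 * (2 * n * work S N True + 1)"
proof -
  let ?L = "len V" and ?W = "2 * n * work S N True"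
  have "work S r p \<le> (m ^ 6 + 2) ^ r" for r p
  proof -
    have "work S r p \<le> (S + 2) ^ r" by (rule work_le[OF S_ge])
    also have "\<dots> \<le> (m ^ 6 + 2) ^ r" using S_le by (intro power_mono) auto
    finally show ?thesis .
  qed
  then obtain k where k: "k \<le> ?W" "loop_inv k (ceval (init m) start)" using loop_inv_init by blast
  obtain t1 where t1: "t1 \<le> K1 * ?L\<^sup>2" "exec (init m) start t1 (ceval (init m) start)"
    using com_boundD[OF K(1) start_bounded] by blast
  obtain t2 k' s where t2: "exec (While guard (body m)) (ceval (init m) start) t2 s" "loop_inv k' s"
    "\<not> bval guard s" "t2 \<le> (H + K2) * ?L\<^sup>2 * (k + 1)"
    using exec_While[where I = loop_inv and L = ?L, OF K(2) H _ _ k(2)] loop_inv_body loop_inv_bounded by blast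
  obtain t3 where t3: "t3 \<le> K3 * ?L\<^sup>2" "exec final s t3 (ceval final s)"
    using com_boundD[OF K(3) loop_inv_bounded[OF t2(2)]] by blast
  have "exec (program m) start (t1 + (t2 + t3)) (ceval final s)"
    unfolding program_def by (rule exec.Seq[OF t1(2) exec.Seq[OF t2(1) t3(2)]])
  moreover have "fst (ceval final s) ''out'' = fst s ''out'' mod M mod B"
    using loop_inv_final[OF t2(2,3)] by (simp add: final_def)
  moreover have "fst s ''out'' mod M mod B = int (card {(i, j). i < n \<and> j < n \<and> (\<Sum>k<d. x (i * d + k) * x ((n + j) * d + k)) mod m = 0})"
    using cong_trans[OF loop_inv_final(1)[OF t2(2,3)] final_value]
    unfolding inner6_blocks by (rule count_from_sum)
  moreover have "t1 + (t2 + t3) \<le> (K1 + H + K2 + K3) * ?L\<^sup>2 * (?W + 1)"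
  proof -
    have "t1 \<le> K1 * ?L\<^sup>2 * (?W + 1)" by (rule order_trans[OF t1(1)]) simp
    moreover have "t2 \<le> (H + K2) * ?L\<^sup>2 * (?W + 1)"
      by (rule order_trans[OF t2(4)]) (use k(1) in \<open>intro mult_left_mono; simp\<close>)
    moreover have "t3 \<le> K3 * ?L\<^sup>2 * (?W + 1)" by (rule order_trans[OF t3(1)]) simp
    ultimately show ?thesis by (simp only: add_mult_distrib)
  qed
  ultimately show ?thesis by metis
qed

end

section \<open>Sparsity of the correction\<close>

text \<open>For composite \<open>m\<close> there is no dimension count. Subtracting one fixed
  solution maps a nonempty fibre of the linear form injectively into its kernel, whatever the
  coefficients are.\<close>

lemma card_zeros_linear_le:
  fixes m a b c r :: nat
  defines "A \<equiv> \<lambda>r. {(x, y, z). x < m \<and> y < m \<and> z < m \<and> (a * x + b * y + c * z) mod m = r}"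
  assumes m: "0 < m"
  shows "card (A r) \<le> card (A 0)"
proof (cases "A r = {}")
  case False
  then obtain x0 y0 z0 where 0: "x0 < m" "y0 < m" "z0 < m" "(a * x0 + b * y0 + c * z0) mod m = r"
    by (auto simp: A_def)
  let ?s = "\<lambda>x x0. (x + (m - x0)) mod m"
  have inj: "x = x'" if "?s x k = ?s x' k" "x < m" "x' < m" for x x' k :: nat
  proof -
    have "[x + (m - k) = x' + (m - k)] (mod m)" using that(1) by (simp add: cong_def)
    then have "[x = x'] (mod m)" by (simp only: cong_add_rcancel_nat)
    then show ?thesis using that by (simp add: cong_def)
  qed
  have fin: "finite (A 0)"
    by (rule finite_subset[of _ "{..<m} \<times> {..<m} \<times> {..<m}"]) (auto simp: A_def)
  show ?thesis
  proof (rule card_inj_on_le[of "\<lambda>(x, y, z). (?s x x0, ?s y y0, ?s z z0)"])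
    show "inj_on (\<lambda>(x, y, z). (?s x x0, ?s y y0, ?s z z0)) (A r)"
      by (auto simp: inj_on_def A_def dest: inj)
    show "(\<lambda>(x, y, z). (?s x x0, ?s y y0, ?s z z0)) ` A r \<subseteq> A 0"
    proof clarify
      fix x y z assume "(x, y, z) \<in> A r"
      then have xyz: "x < m" "y < m" "z < m" "(a * x + b * y + c * z) mod m = r" by (auto simp: A_def)
      let ?t = "a * (x + (m - x0)) + b * (y + (m - y0)) + c * (z + (m - z0))"
      have "[a * ?s x x0 + b * ?s y y0 + c * ?s z z0 = ?t] (mod m)"
        by (intro cong_add cong_mult cong_mod_leftI cong_refl)
      then have "[a * ?s x x0 + b * ?s y y0 + c * ?s z z0 + (a * x0 + b * y0 + c * z0) = ?t + (a * x0 + b * y0 + c * z0)] (mod m)"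
        by (rule cong_add) (rule cong_refl)
      also have "?t + (a * x0 + b * y0 + c * z0) = (a + b + c) * m + (a * x + b * y + c * z)"
      proof -
        have "a * (x + (m - x0)) + a * x0 = a * m + a * x" "b * (y + (m - y0)) + b * y0 = b * m + b * y"
          "c * (z + (m - z0)) + c * z0 = c * m + c * z"
          using 0(1-3) by (simp_all flip: distrib_left)
        then show ?thesis by (simp add: distrib_right)
      qed
      also have "[(a + b + c) * m + (a * x + b * y + c * z) = 0 + (a * x0 + b * y0 + c * z0)] (mod m)"
        using 0(4) xyz(4) by (simp add: cong_def)
      finally have "[a * ?s x x0 + b * ?s y y0 + c * ?s z z0 = 0] (mod m)"
        by (simp only: cong_add_rcancel_nat)
      then show "(?s x x0, ?s y y0, ?s z z0) \<in> A 0"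
        using m by (simp add: A_def cong_def)
    qed
  qed (rule fin)
qed simp

text \<open>The \<open>m\<close> fibres partition \<open>m ^ 3\<close> points and the kernel is a
  largest one, so it has at least the average size.\<close>

lemma card_zeros_linear:
  fixes m a b c :: nat
  assumes m: "0 < m"
  shows "m ^ 2 \<le> card {(x, y, z). x < m \<and> y < m \<and> z < m \<and> (a * x + b * y + c * z) mod m = 0}"
    (is "_ \<le> card ?Z")
proof -
  let ?U = "{..<m} \<times> {..<m} \<times> {..<m}"
  let ?g = "\<lambda>(x, y, z). (a * x + b * y + c * z) mod m"
  have "m * m ^ 2 = card ?U"
    by (simp add: card_cartesian_product power2_eq_square)
  also have "\<dots> = (\<Sum>u\<in>?U. 1)" by simp
  also have "\<dots> = (\<Sum>r<m. \<Sum>u\<in>{u \<in> ?U. ?g u = r}. 1)"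
    using m by (intro sum.group[symmetric]) auto
  also have "\<dots> \<le> (\<Sum>r<m. card ?Z)"
  proof (rule sum_mono)
    fix r
    have "{u \<in> ?U. ?g u = r} = {(x, y, z). x < m \<and> y < m \<and> z < m \<and> (a * x + b * y + c * z) mod m = r}"
      by auto
    then show "(\<Sum>u\<in>{u \<in> ?U. ?g u = r}. 1) \<le> card ?Z"
      using card_zeros_linear_le[OF m, of a b c r] by simp
  qed
  finally show ?thesis using m by simp
qed

definition quad_zeros :: "nat \<Rightarrow> ((nat \<times> nat \<times> nat) \<times> nat \<times> nat \<times> nat) set" where
  "quad_zeros m = {((a, b, c), x, y, z). a < m \<and> b < m \<and> c < m \<and> x < m \<and> y < m \<and> z < m \<and>
     (a * x + b * y + c * z) mod m = 0}"

lemma card_quad_zeros: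
  assumes "0 < m" shows "m ^ 5 \<le> card (quad_zeros m)"
proof -
  let ?U = "{..<m} \<times> {..<m} \<times> {..<m}"
  let ?Z = "\<lambda>(a, b, c). {(x, y, z). x < m \<and> y < m \<and> z < m \<and> (a * x + b * y + c * z) mod m = 0}"
  have fin: "finite (?Z e)" for e
    by (rule finite_subset[of _ ?U]) auto
  have "quad_zeros m = Sigma ?U ?Z" by (auto simp: quad_zeros_def)
  then have "card (quad_zeros m) = (\<Sum>e\<in>?U. card (?Z e))"
    using card_SigmaI[of ?U ?Z] fin by simp
  moreover have "(\<Sum>e\<in>?U. m ^ 2) \<le> (\<Sum>e\<in>?U. card (?Z e))"
    using card_zeros_linear[OF assms] by (intro sum_mono) auto
  moreover have "(\<Sum>e\<in>?U. m ^ 2) = m ^ 5"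
    by (simp add: card_cartesian_product eval_nat_numeral)
  ultimately show ?thesis by simp
qed

text \<open>A hyperbolic quadric in six variables over the field with two elements has
  \<open>2^5 + 2^2\<close> zeros. The surplus of 4 over \<open>m ^ 5\<close> matters: with 32
  nonzeros per row the base would be about 1.372.\<close>

lemma card_quad_zeros_2: "card (quad_zeros 2) = 36"
proof -
  have "quad_zeros 2 = set (filter (\<lambda>((a, b, c), x, y, z). (a * x + b * y + c * z) mod 2 = 0)
     (List.product (List.product [0..<2] (List.product [0..<2] [0..<2]))
        (List.product [0..<2] (List.product [0..<2] [0..<2]))))"
    unfolding quad_zeros_def by auto
  also have "card \<dots> = 36"
    by code_simp
  finally show ?thesis .
qed

text \<open>Swapping paired coordinates and translating by \<open>y\<close> permutes
  \<open>Z_m^6\<close>, so every row of the matrix has as many zero exponents as the form has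
  zeros.\<close>

lemma card_bent_zeros:
  assumes m: "0 < m"
  shows "card (quad_zeros m) \<le> card {z. z < m ^ 6 \<and> bent m y (digit m z) = 0}"
proof -
  \<comment> \<open>\<open>s k\<close> subtracts \<open>y k\<close> modulo \<open>m\<close>. In
    \<open>t\<close> the positions of each pair are exchanged because \<open>bent\<close> adds
    coordinate 1 of \<open>z\<close> to coordinate 0 of \<open>y\<close>, and so on.\<close>
  define s where "s k x = (x + (m - 1) * y k) mod m" for k x
  define t :: "nat \<Rightarrow> nat \<Rightarrow> nat \<Rightarrow> nat \<Rightarrow> nat \<Rightarrow> nat \<Rightarrow> nat \<Rightarrow> nat" where
    "t a b c x1 x2 x3 = (\<lambda>_. 0)(1 := s 0 a, 0 := s 1 x1, 3 := s 2 b, 2 := s 3 x2, 5 := s 4 c, 4 := s 5 x3)"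
    for a b c x1 x2 x3
  define f where "f = (\<lambda>((a, b, c), x1, x2, x3). encode m (t a b c x1 x2 x3))"
  have s_less: "s k x < m" for k x using m by (simp add: s_def)
  have s: "[y k + s k x = x] (mod m)" for k x
  proof -
    have "[y k + s k x = y k + (x + (m - 1) * y k)] (mod m)"
      by (intro cong_add) (auto simp: s_def cong_def)
    also have "y k + (x + (m - 1) * y k) = m * y k + x"
      using m by (cases m) auto
    also have "[\<dots> = x] (mod m)" by (simp add: cong_def)
    finally show ?thesis .
  qed
  have s_inj: "x = x'" if "s k x = s k x'" "x < m" "x' < m" for k x x'
  proof -
    have "[x = x'] (mod m)" using s[of k x] s[of k x'] that(1) by (metis cong_sym cong_trans)
    then show ?thesis using that by (simp add: cong_def)
  qed
  have t_less: "t a b c x1 x2 x3 j < m" for a b c x1 x2 x3 j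
    using m s_less by (simp add: t_def)
  have dig: "digit m (encode m (t a b c x1 x2 x3)) j = t a b c x1 x2 x3 j" if "j < 6" for a b c x1 x2 x3 j
    using that by (intro digit_encode t_less)
  show ?thesis
  proof (rule card_inj_on_le[of f])
    show "inj_on f (quad_zeros m)"
    proof (rule inj_onI)
      fix u u' assume u: "u \<in> quad_zeros m" "u' \<in> quad_zeros m" "f u = f u'"
      obtain a b c x1 x2 x3 where U: "u = ((a, b, c), x1, x2, x3)" by (metis prod.exhaust)
      obtain a' b' c' x1' x2' x3' where U': "u' = ((a', b', c'), x1', x2', x3')" by (metis prod.exhaust)
      have Z: "((a, b, c), x1, x2, x3) \<in> quad_zeros m" "((a', b', c'), x1', x2', x3') \<in> quad_zeros m"
        and "f ((a, b, c), x1, x2, x3) = f ((a', b', c'), x1', x2', x3')"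
        using u by (simp_all add: U U')
      then have eq: "t a b c x1 x2 x3 j = t a' b' c' x1' x2' x3' j" if "j < 6" for j
        using dig[OF that, of a b c x1 x2 x3] dig[OF that, of a' b' c' x1' x2' x3'] by (simp only: f_def prod.case)
      show "u = u'" unfolding U U'
        using eq[of 0] eq[of 1] eq[of 2] eq[of 3] eq[of 4] eq[of 5] Z s_inj by (auto simp: quad_zeros_def t_def)
    qed
    show "f ` quad_zeros m \<subseteq> {z. z < m ^ 6 \<and> bent m y (digit m z) = 0}"
    proof clarify
      fix a b c x1 x2 x3 assume Z: "((a, b, c), x1, x2, x3) \<in> quad_zeros m"
      have "bent m y (digit m (f ((a, b, c), x1, x2, x3))) = bent m y (t a b c x1 x2 x3)"
        unfolding f_def prod.case by (intro bent_cong dig)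
      also have "\<dots> = ((y 0 + s 0 a) * (y 1 + s 1 x1) + (y 2 + s 2 b) * (y 3 + s 3 x2)
          + (y 4 + s 4 c) * (y 5 + s 5 x3)) mod m"
        by (simp add: bent_def t_def)
      also have "\<dots> = (a * x1 + b * x2 + c * x3) mod m"
        unfolding cong_def[symmetric] by (intro cong_add cong_mult s)
      also have "\<dots> = 0" using Z by (simp add: quad_zeros_def)
      finally show "f ((a, b, c), x1, x2, x3) < m ^ 6 \<and> bent m y (digit m (f ((a, b, c), x1, x2, x3))) = 0"
        unfolding f_def prod.case using encode_less[of "t a b c x1 x2 x3" m] t_less by blast
    qed
  qed simp
qed

lemma card_bent_nonzeros:
  assumes m: "0 < m"
  shows "card {z. z < m ^ 6 \<and> bent m y (digit m z) \<noteq> 0} \<le> m ^ 6 - card (quad_zeros m)"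
proof -
  let ?Z = "{z. z < m ^ 6 \<and> bent m y (digit m z) = 0}"
  have "{z. z < m ^ 6 \<and> bent m y (digit m z) \<noteq> 0} = {..<m ^ 6} - ?Z" by auto
  moreover have "card ({..<m ^ 6} - ?Z) = m ^ 6 - card ?Z"
    by (subst card_Diff_subset) auto
  ultimately show ?thesis using card_bent_zeros[OF m, of y] by simp
qed

text \<open>Without its constant term the recurrence has the eigenvector \<open>(1, sqrt S)\<close>
  with eigenvalue \<open>1 + sqrt S\<close>. The summand \<open>- 1\<close> in the bound pays for
  the 1 added at each level, using \<open>1 \<le> sqrt S\<close>.\<close>

lemma work_le_real:
  assumes "1 \<le> S"
  shows "real (work S r p) \<le> (if p then sqrt S else 1) * (2 * (1 + sqrt S) ^ r - 1)"
proof (induction r arbitrary: p)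
  case 0
  then show ?case using assms by simp
next
  case (Suc r)
  define s where "s = sqrt S"
  define P where "P = (1 + s) ^ r"
  have s: "1 \<le> s" "s * s = S" using assms by (auto simp: s_def)
  have F: "real (work S r False) \<le> 2 * P - 1" and T: "real (work S r True) \<le> s * (2 * P - 1)"
    using Suc.IH[of False] Suc.IH[of True] by (simp_all add: s_def P_def)
  show ?case
  proof (cases p)
    case True
    have "real (work S (Suc r) p) \<le> 1 + s * (2 * P - 1) + s * s * (2 * P - 1)"
      using True T mult_left_mono[OF F, of "real S"] by (simp add: s)
    also have "\<dots> = s * (2 * (1 + s) * P - 1) + (1 - s * s)"
      by (simp add: algebra_simps)
    also have "\<dots> \<le> s * (2 * (1 + s) * P - 1)"
      using assms s by simp
    finally show ?thesis using True by (simp only: s_def P_def mult.assoc if_True power_Suc)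
  next
    case False
    have "real (work S (Suc r) p) \<le> 1 + (2 * P - 1) + s * (2 * P - 1)"
      using False T F by simp
    also have "\<dots> = 2 * (1 + s) * P - s"
      by (simp add: algebra_simps)
    also have "\<dots> \<le> 2 * (1 + s) * P - 1"
      using s by simp
    finally show ?thesis using False by (simp only: s_def P_def mult.assoc if_False power_Suc mult_1)
  qed
qed

section \<open>Bit length of \<open>V\<close> and the total running time\<close>

lemma len_le_log:
  assumes "1 \<le> x"
  shows "real (len x) \<le> 2 + log 2 (real_of_int x)"
proof -
  have "floorlog 2 (nat x) = nat \<lfloor>log 2 (real_of_int x)\<rfloor> + 1"
    using assms by (simp add: floorlog_def)
  moreover have "0 \<le> log 2 (real_of_int x)" using assms by simp
  moreover have "\<bar>x\<bar> = x" using assms by simp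
  ultimately show ?thesis
    unfolding len_def using of_int_floor_le[of "log 2 (real_of_int x)"] by simp
qed

lemma (in ov_machine) len_V_le:
  "real (len V) \<le> (2 + (real m + 1) + 2 * (real m + 1) / ln 2 + log 2 (real m ^ 6 + 2)) *
     (1 + real d + ln (real n))"
proof -
  let ?n = "real n"
  have n: "1 \<le> ?n" using n_ge1 by simp
  have V: "real_of_int V = (?n * ?n + 1) ^ (m + 1) * (real m ^ 6 + 2) ^ d"
    by (simp add: V_def B_def)
  have "real (len V) \<le> 2 + log 2 (real_of_int V)"
    using one_less_V by (intro len_le_log) simp
  also have "log 2 (real_of_int V) = real (m + 1) * log 2 (?n * ?n + 1) + real d * log 2 (real m ^ 6 + 2)"
  proof -
    have pos: "0 < ?n * ?n + 1" "0 < real m ^ 6 + 2" by (simp_all add: add_nonneg_pos)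
    then have "(?n * ?n + 1) ^ (m + 1) \<noteq> 0" "(real m ^ 6 + 2) ^ d \<noteq> 0" by auto
    then show ?thesis unfolding V by (simp only: log_mult log_nat_power[OF less_imp_le[OF pos(1)]] log_nat_power[OF less_imp_le[OF pos(2)]] simp_thms if_True)
  qed
  also have "log 2 (?n * ?n + 1) \<le> 1 + 2 * ln ?n / ln 2"
  proof -
    have "1 * 1 \<le> ?n * ?n" using n by (intro mult_mono) auto
    then have "log 2 (?n * ?n + 1) \<le> log 2 (2 * (?n * ?n))"
      using n by (subst log_le_cancel_iff) (auto simp: add_nonneg_pos)
    also have "\<dots> = 1 + 2 * ln ?n / ln 2"
      using n by (simp add: log_mult) (simp add: log_def)
    finally show ?thesis .
  qed
  finally have *: "real (len V) \<le> 2 + (real (m + 1) * (1 + 2 * ln ?n / ln 2) + real d * log 2 (real m ^ 6 + 2))"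
    by (simp add: mult_left_mono)
  define A where "A = 2 + (real m + 1)"
  define C where "C = 2 * (real m + 1) / ln 2"
  define D where "D = log 2 (real m ^ 6 + 2)"
  have "0 \<le> log 2 (1 + (real m ^ 6 + 1))" by (subst zero_le_log_cancel_iff) (auto simp: add_pos_nonneg)
  then have nonneg: "0 \<le> A" "0 \<le> C" "0 \<le> D" "0 \<le> ln ?n" "0 \<le> real d"
    using n by (auto simp: A_def C_def D_def add.commute)
  have "real (len V) \<le> A * 1 + C * ln ?n + D * real d"
    using * by (simp add: A_def C_def D_def algebra_simps)
  also have "\<dots> \<le> A * (1 + real d + ln ?n) + C * (1 + real d + ln ?n) + D * (1 + real d + ln ?n)"
    using nonneg by (intro add_mono mult_left_mono) auto
  also have "\<dots> = (A + C + D) * (1 + real d + ln ?n)" by (simp add: algebra_simps)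
  finally show ?thesis by (simp add: A_def C_def D_def)
qed

lemma concat_nth:
  assumes "\<forall>u\<in>set us. length u = d" "i < length us" "k < d"
  shows "i * d + k < length (concat us) \<and> concat us ! (i * d + k) = us ! i ! k"
  using assms
proof (induction us arbitrary: i)
  case (Cons u us)
  show ?case
  proof (cases i)
    case (Suc i')
    then show ?thesis using Cons.IH[of i'] Cons.prems by (simp add: nth_append)
  qed (use Cons.prems in \<open>simp add: nth_append\<close>)
qed simp

lemma length_concat_same: "\<forall>u\<in>set us. length u = d \<Longrightarrow> length (concat us) = length us * d"
  by (induction us) auto

lemma count_OV_solvable:
  fixes h :: "nat \<Rightarrow> real"
  assumes m: "2 \<le> m" and S: "1 \<le> S" "S \<le> m ^ 6"
    and bent: "\<And>y. card {z. z < m ^ 6 \<and> bent m y (digit m z) \<noteq> 0} \<le> S"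
    and h: "\<And>d. (1 + sqrt S) powr (real d / 6) \<le> h d"
  shows "count_OV_solvable_in_time m (\<lambda>n d. real n * h d)"
proof -
  obtain K1 where K1: "com_bound (init m) K1" using com_bound_ex[OF loop_free_init] by blast
  obtain K2 where K2: "com_bound (body m) K2" using com_bound_ex[OF loop_free_body] by blast
  obtain K3 where K3: "com_bound final K3" using com_bound_ex[of final] by (auto simp: final_def)
  obtain H where H: "\<forall>s L. bounded L s \<longrightarrow> bcost guard s \<le> H * L\<^sup>2" using bexp_bound_ex by blast
  define cost where "cost = real (K1 + H + K2 + K3)"
  define c where "c = 2 + (real m + 1) + 2 * (real m + 1) / ln 2 + log 2 (real m ^ 6 + 2)"
  define \<beta> where "\<beta> = 1 + sqrt S"
  \<comment> \<open>One factor \<open>\<beta>\<close> pays for rounding \<open>d / 6\<close> up to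
    \<open>N\<close>, and \<open>sqrt S\<close> for starting with the flag \<open>True\<close>. The
    5 is 4 from \<open>2 * n\<close> vectors of doubled work, plus 1 for the steps outside the loop
    and its last test. The square comes from the quadratic cost in the bit length.\<close>
  define T where "T n d = cost * c\<^sup>2 * (5 * sqrt S * \<beta>) * (real n * h d) * (1 + real d + ln (real n)) ^ 2" for n d
  have \<beta>: "2 \<le> \<beta>" "1 \<le> sqrt S" using S by (auto simp: \<beta>_def)
  have "solves_count_OV_in_time (program m) m T"
    unfolding solves_count_OV_in_time_def
  proof (intro allI impI ballI)
    fix n d us vs assume n: "1 \<le> (n :: nat)" and us: "us \<in> vector_lists m d n" and vs: "vs \<in> vector_lists m d n"
    let ?xs = "concat us @ concat vs"
    \<comment> \<open>The default 0 makes \<open>x a < m\<close> true at every address, as the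
      locale demands.\<close>
    define x where "x a = (if a < 2 * n * d then nat (?xs ! a) else 0)" for a
    have us': "length us = n" "\<forall>u\<in>set us. length u = d" "\<forall>u\<in>set us. set u \<subseteq> {0..<int m}"
      and vs': "length vs = n" "\<forall>u\<in>set vs. length u = d" "\<forall>u\<in>set vs. set u \<subseteq> {0..<int m}"
      using us vs by (auto simp: vector_lists_def)
    have len: "length (concat us) = n * d" "length ?xs = 2 * n * d"
      using length_concat_same[OF us'(2)] length_concat_same[OF vs'(2)] us'(1) vs'(1) by auto
    have range: "?xs ! a \<in> {0..<int m}" if "a < 2 * n * d" for a
    proof -
      have "?xs ! a \<in> set ?xs" using that len(2) by (intro nth_mem) (simp only:)
      then show ?thesis using us'(3) vs'(3) unfolding set_append set_concat by blast
    qed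
    interpret ov_machine m n d S x
    proof
      show "x a < m" for a using range[of a] m by (auto simp: x_def)
    qed (use m n S bent in auto)
    have x_int: "int (x a) = ?xs ! a" if "a < 2 * n * d" for a
      using range[OF that] that by (simp add: x_def)
    have x_us: "int (x (i * d + k)) = us ! i ! k" if "i < n" "k < d" for i k
      using concat_nth[OF us'(2), of i k] that us'(1) len x_int[of "i * d + k"] by (simp add: nth_append)
    have x_vs: "int (x ((n + j) * d + k)) = vs ! j ! k" if "j < n" "k < d" for j k
    proof -
      have "j * d + k < length (concat vs)" "concat vs ! (j * d + k) = vs ! j ! k"
        using concat_nth[OF vs'(2), of j k] that vs'(1) by auto
      then show ?thesis
        using len x_int[of "(n + j) * d + k"] by (simp add: nth_append distrib_right add.assoc)
    qed
    have start: "start = input_state n d us vs"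
    proof -
      have "(if 0 \<le> a \<and> a < int (2 * n * d) then int (x (nat a)) else 0) =
        (if 0 \<le> a \<and> a < int (length ?xs) then ?xs ! nat a else 0)" for a
        using x_int[of "nat a"] len(2) by (auto simp: zless_nat_eq_int_zless nat_less_iff)
      then show ?thesis by (simp add: start_def input_state_def Let_def)
    qed
    have iff: "(\<Sum>k<d. x (i * d + k) * x ((n + j) * d + k)) mod m = 0 \<longleftrightarrow>
        [(\<Sum>k<d. us ! i ! k * vs ! j ! k) = 0] (mod int m)" if "i < n" "j < n" for i j
    proof -
      have "(\<Sum>k<d. us ! i ! k * vs ! j ! k) = int (\<Sum>k<d. x (i * d + k) * x ((n + j) * d + k))"
        using x_us x_vs that by simp
      then show ?thesis by (simp only: cong_0_iff int_dvd_int_iff mod_eq_0_iff_dvd)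
    qed
    have count: "{(i, j). i < n \<and> j < n \<and> (\<Sum>k<d. x (i * d + k) * x ((n + j) * d + k)) mod m = 0}
      = {(i, j). i < n \<and> j < n \<and> [(\<Sum>k<d. us ! i ! k * vs ! j ! k) = 0] (mod int m)}"
      unfolding case_prod_beta by (intro Collect_cong conj_cong refl iff)
    obtain t s where ts: "exec (program m) start t s"
      "fst s ''out'' = int (count_OV m d n us vs)"
      "t \<le> (K1 + H + K2 + K3) * (len V)\<^sup>2 * (2 * n * work S N True + 1)"
      using exec_program[OF K1 K2 K3 H, unfolded count, folded count_OV_def] by (elim exE conjE)
    have "real t \<le> real ((K1 + H + K2 + K3) * (len V)\<^sup>2 * (2 * n * work S N True + 1))"
      using ts(3) by (simp only: of_nat_le_iff)
    also have "\<dots> = cost * (real (len V))\<^sup>2 * (2 * real n * real (work S N True) + 1)"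
      by (simp only: cost_def of_nat_mult of_nat_add of_nat_power of_nat_1 of_nat_numeral)
    also have "\<dots> \<le> cost * (c * (1 + real d + ln (real n)))\<^sup>2 * (5 * sqrt S * \<beta> * (real n * h d))"
    proof (intro mult_mono power_mono)
      show "real (len V) \<le> c * (1 + real d + ln (real n))"
        unfolding c_def by (rule len_V_le)
      have "real (work S N True) \<le> sqrt S * (2 * \<beta> ^ N - 1)"
        using work_le_real[OF S(1), of N True] by (simp add: \<beta>_def)
      also have "\<dots> \<le> sqrt S * (2 * \<beta> ^ N)"
        by (intro mult_left_mono) auto
      also have "\<beta> ^ N = \<beta> powr real N" using \<beta> by (simp add: powr_realpow)
      also have "\<dots> \<le> \<beta> powr (1 + real d / 6)"
        using \<beta> by (intro powr_mono) (auto simp: N_def)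
      also have "\<dots> = \<beta> * \<beta> powr (real d / 6)" using \<beta> by (simp add: powr_add)
      also have "\<dots> \<le> \<beta> * h d" using h[of d] \<beta> unfolding \<beta>_def by (intro mult_left_mono) auto
      finally have w: "real (work S N True) \<le> sqrt S * (2 * (\<beta> * h d))"
        using \<beta> by (simp add: mult_left_mono)
      have "1 \<le> \<beta> powr (real d / 6)" using \<beta> by (intro ge_one_powr_ge_zero) auto
      then have hd: "1 \<le> h d" using h[of d] by (simp add: \<beta>_def)
      have "1 * 1 * (1 * 1) \<le> sqrt S * \<beta> * (real n * h d)"
        using \<beta> hd n by (intro mult_mono) auto
      moreover have "2 * real n * real (work S N True) \<le> 2 * real n * (sqrt S * (2 * (\<beta> * h d)))"
        using w by (intro mult_left_mono) auto
      ultimately show "2 * real n * real (work S N True) + 1 \<le> 5 * sqrt S * \<beta> * (real n * h d)"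
        by (simp add: algebra_simps)
    qed (use \<beta> in \<open>auto simp: cost_def\<close>)
    also have "\<dots> = T n d" by (simp add: T_def power_mult_distrib mult_ac)
    finally show "\<exists>t s. exec (program m) (input_state n d us vs) t s \<and>
        fst s ''out'' = int (count_OV m d n us vs) \<and> real t \<le> T n d"
      using ts(1)[unfolded start] ts(2) by blast
  qed
  moreover have "T \<in> soft_O (\<lambda>n d. real n * h d)"
    unfolding soft_O_def T_def by blast
  ultimately show ?thesis unfolding count_OV_solvable_in_time_def by blast
qed

text \<open>The number \<open>a\<close> that solves
  \<open>1 + sqrt (m^6 - m^5) = m powr (6 * (1/2 - a))\<close>, so the growth per block becomes a
  power of \<open>m\<close> without loss.\<close>

definition saving :: "nat \<Rightarrow> real" where
  "saving m = 1 / 2 - ln (1 + sqrt (real (m ^ 6 - m ^ 5))) / (6 * ln (real m))"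

text \<open>The argument yields the stronger bound \<open>1 / (24 * m * ln m)\<close>; the stated
  one follows from \<open>m \<le> m^2\<close>.\<close>

lemma saving_ge:
  assumes m: "2 \<le> m"
  shows "1 / 24 * (1 / (real m ^ 2 * ln (real m))) \<le> saving m"
proof -
  let ?m = "real m"
  have m': "2 \<le> ?m" using m by simp
  have ln: "0 < ln ?m" using m by simp
  have "m ^ 5 \<le> m ^ 6" using m by (intro power_increasing) auto
  then have S: "real (m ^ 6 - m ^ 5) = ?m ^ 6 - ?m ^ 5" by (simp add: of_nat_diff)
  \<comment> \<open>Completing the square: the right-hand side squared exceeds the radicand by
    \<open>m^4 / 4\<close>.\<close>
  have "sqrt (?m ^ 6 - ?m ^ 5) \<le> ?m ^ 3 - ?m ^ 2 / 2"
  proof (rule real_le_lsqrt)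
    have "?m ^ 2 * 1 \<le> ?m ^ 2 * ?m" using m' by (intro mult_left_mono) auto
    then have "?m ^ 2 \<le> ?m ^ 3" by (simp add: eval_nat_numeral)
    then show "0 \<le> ?m ^ 3 - ?m ^ 2 / 2" using zero_le_power2[of ?m] by linarith
    have "(?m ^ 3 - ?m ^ 2 / 2)\<^sup>2 = ?m ^ 6 - ?m ^ 5 + ?m ^ 4 / 4"
      by (simp add: power2_eq_square eval_nat_numeral field_simps)
    then show "?m ^ 6 - ?m ^ 5 \<le> (?m ^ 3 - ?m ^ 2 / 2)\<^sup>2" by simp
  qed
  \<comment> \<open>Thus \<open>1 \<le> m^2 / 4\<close>: half of the gain \<open>m^2 / 2\<close> is
    given up to absorb the summand 1 of the all-ones part.\<close>
  moreover have "2 * 2 \<le> ?m ^ 2" unfolding power2_eq_square using m' by (intro mult_mono) auto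
  ultimately have "1 + sqrt (?m ^ 6 - ?m ^ 5) \<le> ?m ^ 3 - ?m ^ 2 / 4" by simp
  also have "\<dots> = ?m ^ 3 * (1 - 1 / (4 * ?m))"
    using m' by (simp add: eval_nat_numeral field_simps)
  finally have le: "1 + sqrt (?m ^ 6 - ?m ^ 5) \<le> ?m ^ 3 * (1 - 1 / (4 * ?m))" .
  have nn: "0 \<le> sqrt (?m ^ 6 - ?m ^ 5)" using S by (metis of_nat_0_le_iff real_sqrt_ge_zero)
  have pos: "0 < 1 - 1 / (4 * ?m)" using m' by (simp add: field_simps)
  have "ln (1 + sqrt (?m ^ 6 - ?m ^ 5)) \<le> ln (?m ^ 3 * (1 - 1 / (4 * ?m)))"
    using le nn by (intro ln_mono) linarith+
  also have "\<dots> = 3 * ln ?m + ln (1 - 1 / (4 * ?m))"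
    using pos m' by (simp add: ln_mult ln_realpow)
  also have "\<dots> \<le> 3 * ln ?m - 1 / (4 * ?m)"
    using ln_le_minus_one[OF pos] by simp
  finally have "ln (1 + sqrt (?m ^ 6 - ?m ^ 5)) / (6 * ln ?m) \<le> (3 * ln ?m - 1 / (4 * ?m)) / (6 * ln ?m)"
    using ln by (intro divide_right_mono) auto
  also have "\<dots> = 1 / 2 - 1 / (24 * (?m * ln ?m))"
    using ln m' by (simp add: field_simps)
  finally have "1 / (24 * (?m * ln ?m)) \<le> saving m"
    unfolding saving_def S by linarith
  moreover have "1 / 24 * (1 / (?m ^ 2 * ln ?m)) \<le> 1 / (24 * (?m * ln ?m))"
  proof -
    have "?m * ln ?m \<le> ?m ^ 2 * ln ?m"
      using m' ln by (intro mult_right_mono) (auto simp: power2_eq_square)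
    then show ?thesis using m' ln by (simp add: frac_le)
  qed
  ultimately show ?thesis by linarith
qed

lemma saving_powr:
  assumes "2 \<le> m"
  shows "(1 + sqrt (real (m ^ 6 - m ^ 5))) powr (real d / 6) = real m powr ((1 / 2 - saving m) * real d)"
proof -
  have "0 < ln (real m)" using assms by simp
  moreover have "0 < 1 + sqrt (real (m ^ 6 - m ^ 5))" by (simp add: add_pos_nonneg)
  ultimately show ?thesis using assms by (simp add: powr_def saving_def)
qed

theorem theorem1p4:
  "count_OV_solvable_in_time 2 (\<lambda>n d. real n * 1.36 ^ d) \<and>
   (\<exists>a :: nat \<Rightarrow> real.
      (\<forall>m\<ge>2. a m > 0) \<and>
      a \<in> \<Omega>(\<lambda>m. 1 / (real m ^ 2 * ln (real m))) \<and>
      (\<forall>m\<ge>2. count_OV_solvable_in_time m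
                (\<lambda>n d. real n * real m powr ((1/2 - a m) * real d))))"
proof (intro conjI exI[of _ saving] allI impI)
  show "count_OV_solvable_in_time 2 (\<lambda>n d. real n * 1.36 ^ d)"
  proof (rule count_OV_solvable[where S = 28])
    show "card {z. z < 2 ^ 6 \<and> bent 2 y (digit 2 z) \<noteq> 0} \<le> 28" for y
      using card_bent_nonzeros[of 2 y] by (simp add: card_quad_zeros_2)
    show "(1 + sqrt (real 28)) powr (real d / 6) \<le> 1.36 ^ d" for d
    proof -
      \<comment> \<open>The square of 5.3 is 28.09, and 6.3 is still below \<open>1.36 ^ 6\<close>,
        which is about 6.327.\<close>
      have "sqrt 28 \<le> 5.3" by (rule real_le_lsqrt) (simp_all add: power2_eq_square)
      then have "(1 + sqrt 28) powr (real d / 6) \<le> (1.36 ^ 6) powr (real d / 6)"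
        by (intro powr_mono2) (auto simp: eval_nat_numeral)
      also have "\<dots> = (1.36 powr 6) powr (real d / 6)"
        by (subst powr_numeral) auto
      also have "\<dots> = 1.36 powr real d"
        by (subst powr_powr) simp
      also have "\<dots> = 1.36 ^ d" by (simp add: powr_realpow)
      finally show ?thesis by simp
    qed
  qed simp_all
next
  fix m :: nat assume m: "2 \<le> m"
  have "0 < 1 / 24 * (1 / (real m ^ 2 * ln (real m)))" using m by simp
  then show "0 < saving m" using saving_ge[OF m] by linarith
next
  show "saving \<in> \<Omega>(\<lambda>m. 1 / (real m ^ 2 * ln (real m)))"
  proof (rule landau_omega.bigI[of "1 / 24"])
    show "eventually (\<lambda>m. norm (saving m) \<ge> 1 / 24 * norm (1 / (real m ^ 2 * ln (real m)))) at_top"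
      using eventually_ge_at_top[of 2]
    proof eventually_elim
      case (elim m)
      then have "norm (1 / (real m ^ 2 * ln (real m))) = 1 / (real m ^ 2 * ln (real m))" by simp
      then show ?case using saving_ge[OF elim] by simp
    qed
  qed simp
next
  fix m :: nat assume m: "2 \<le> m"
  \<comment> \<open>Strictness supplies \<open>1 \<le> S\<close> for
    \<open>S = m ^ 6 - m ^ 5\<close>.\<close>
  have "m ^ 5 < m ^ 6" using m by (intro power_strict_increasing) auto
  moreover have "card {z. z < m ^ 6 \<and> bent m y (digit m z) \<noteq> 0} \<le> m ^ 6 - m ^ 5" for y
    using card_quad_zeros[of m] card_bent_nonzeros[of m y] m by linarith
  ultimately show "count_OV_solvable_in_time m (\<lambda>n d. real n * real m powr ((1/2 - saving m) * real d))"
    using saving_powr[OF m] by (intro count_OV_solvable[OF m, where S = "m ^ 6 - m ^ 5"]) simp_all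
qed

end
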